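(* Let $\Bbbk$ be a field, let $n = 2k+1$ with $k \ge 15$ and $k \equiv 1$ or $2 \pmod 4$, and let $R = \Bbbk[x_1,\dots,x_n]$. Define the following sets of squarefree monomials: - $G_1 = \{x_{2i}x_{2j} \mid 1 \le i < j \le k\} \cup \{x_3x_2,\ x_5x_2\}$; - $\mathrm{NF} = \{x_i x_j \mid 1 \le i,j\le n,\ i \text{ odd},\ j \text{ even},\ i+1 < j\} \cup \{x_2x_7,\ x_2x_9\}$; - $G_2 = \{x_i x_j x_{2k+1} \mid 1 \le i < j \le 2k,\ x_i x_j \notin G_1 \cup \mathrm{NF}\}$; - $G_3 = \{x_i x_j x_l \mid 1 \le i < j < l \le 2k,\ i,j,l \text{ odd}\}$; - $G_4$: any set of exactly $$\frac12\cdot\frac{4k^3+3k^2-13k+6}{6} - \frac{k(k-1)(k-2)+6k^2-24}{6}$$ squarefree monomials of degree 3 in $R$, none belonging to $G_2 \cup G_3$ and none divisible by a monomial of $G_1 \cup \mathrm{NF}$. Then the ideal $I = \langle G_1 \cup G_2 \cup G_3 \cup G_4\rangle$ is an $f$-ideal.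
   Context: Let $I \subseteq \Bbbk[x_1,\dots,x_n]$ be a squarefree monomial ideal whose minimal monomial generators all have degree at least 2. Identify a subset $F \subseteq \{x_1,\dots,x_n\}$ with the squarefree monomial $x_F = \prod_{x_i \in F} x_i$. The Stanley-Reisner complex $\Delta_I$ is the simplicial complex whose faces are the sets $F$ with $x_F \notin I$. The facet complex $\Delta(I)$ is the simplicial complex whose facets are the sets $F$ such that $x_F$ is a minimal generator of $I$; that is, its faces are the sets $F$ such that $x_F$ divides some minimal generator of $I$. The $f$-vector of a simplicial complex of dimension $e$ is $(f_{-1},f_0,\dots,f_e)$, where $f_i$ is the number of faces with $i+1$ elements ($f_{-1}=1$ for a nonempty complex). The ideal $I$ is called an $f$-ideal if $\Delta_I$ and $\Delta(I)$ have the same $f$-vector. *)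

theory Defs
  imports Complex_Main "HOL-Algebra.Ideal" "HOL-Library.Poly_Mapping"
begin

text \<open>
  A polynomial over \<open>'a\<close> in the variables \<open>x\<^sub>0, x\<^sub>1, x\<^sub>2, \<dots>\<close> is a finitely supported map from
  exponent vectors to coefficients; multiplication on this type is convolution, i.e. the
  usual multiplication of polynomials. The ring of polynomials in \<open>x\<^sub>1, \<dots>, x\<^sub>n\<close> is the subring of
  those polynomials in which only these variables occur.
\<close>

type_synonym 'a polynomial = "(nat \<Rightarrow>\<^sub>0 nat) \<Rightarrow>\<^sub>0 'a"

definition var :: "nat \<Rightarrow> 'a::field polynomial" where
  "var i = Poly_Mapping.single (Poly_Mapping.single i 1) 1"

definition poly_ring :: "nat \<Rightarrow> 'a::field polynomial ring" where
  "poly_ring n =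
     \<lparr>carrier = {p. \<forall>m\<in>Poly_Mapping.keys p. Poly_Mapping.keys m \<subseteq> {1..n}},
      mult = (*), one = 1, zero = 0, add = (+)\<rparr>"

definition monomial :: "(nat \<Rightarrow>\<^sub>0 nat) \<Rightarrow> 'a::field polynomial" where
  "monomial m = Poly_Mapping.single m 1"

definition monomials :: "nat \<Rightarrow> 'a::field polynomial set" where
  "monomials n = {monomial m | m. Poly_Mapping.keys m \<subseteq> {1..n}}"

definition mdegree :: "(nat \<Rightarrow>\<^sub>0 nat) \<Rightarrow> nat" where
  "mdegree m = (\<Sum>i\<in>Poly_Mapping.keys m. Poly_Mapping.lookup m i)"

definition sqfree_monomial :: "nat set \<Rightarrow> 'a::field polynomial" where
  "sqfree_monomial F = (\<Prod>i\<in>F. var i)"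

definition sqfree_monomial_ideal :: "nat \<Rightarrow> 'a::field polynomial set \<Rightarrow> bool" where
  "sqfree_monomial_ideal n I \<longleftrightarrow>
     (\<exists>S. S \<subseteq> {sqfree_monomial F | F. F \<subseteq> {1..n}} \<and> I = Idl\<^bsub>poly_ring n\<^esub> S)"

definition min_monomial_gen_set :: "nat \<Rightarrow> 'a::field polynomial set \<Rightarrow> 'a polynomial set \<Rightarrow> bool" where
  "min_monomial_gen_set n I G \<longleftrightarrow>
     G \<subseteq> monomials n \<and> Idl\<^bsub>poly_ring n\<^esub> G = I \<and> (\<forall>H. H \<subset> G \<longrightarrow> Idl\<^bsub>poly_ring n\<^esub> H \<noteq> I)"

text \<open>
  The set below is well defined for squarefree monomial ideals, by lemma
  \<open>min_monomial_gen_set_unique\<close>.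
\<close>

definition min_gens :: "nat \<Rightarrow> 'a::field polynomial set \<Rightarrow> 'a polynomial set" where
  "min_gens n I = (THE G. min_monomial_gen_set n I G)"

text \<open>
  Simplicial complexes are represented by their sets of faces, with the variable \<open>x\<^sub>i\<close> as
  vertex \<open>i\<close>. Divisibility of polynomials is taken in the ring in all variables; a cofactor
  of a nonzero element of \<open>poly_ring n\<close> automatically lies in \<open>poly_ring n\<close>.
\<close>

definition stanley_reisner_complex :: "nat \<Rightarrow> 'a::field polynomial set \<Rightarrow> nat set set" where
  "stanley_reisner_complex n I = {F. F \<subseteq> {1..n} \<and> sqfree_monomial F \<notin> I}"

definition facet_complex :: "nat \<Rightarrow> 'a::field polynomial set \<Rightarrow> nat set set" where
  "facet_complex n I = {F. F \<subseteq> {1..n} \<and> (\<exists>g\<in>min_gens n I. sqfree_monomial F dvd g)}"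

text \<open>
  The entry at list position \<open>j\<close> is the number \<open>f\<^bsub>j - 1\<^esub>\<close> of faces with \<open>j\<close> elements. The largest
  cardinality of a face is one more than the dimension. The complex without any
  face has the empty \<open>f\<close>-vector.
\<close>

definition f_vector :: "nat set set \<Rightarrow> nat list" where
  "f_vector \<Delta> =
     (if \<Delta> = {} then []
      else map (\<lambda>j. card {F \<in> \<Delta>. card F = j}) [0..<Suc (Max (card ` \<Delta>))])"

definition f_ideal :: "nat \<Rightarrow> 'a::field polynomial set \<Rightarrow> bool" where
  "f_ideal n I \<longleftrightarrow>
     sqfree_monomial_ideal n I \<and>
     (\<forall>m. monomial m \<in> min_gens n I \<longrightarrow> 2 \<le> mdegree m) \<and>
     f_vector (stanley_reisner_complex n I) = f_vector (facet_complex n I)"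


lemma poly_ring_cring: "cring (poly_ring n :: 'a::field polynomial ring)"
proof (rule cringI)
  let ?R = "poly_ring n :: 'a polynomial ring"
  show "abelian_group ?R"
  proof (rule abelian_groupI)
    fix x y assume "x \<in> carrier ?R" "y \<in> carrier ?R"
    then show "x \<oplus>\<^bsub>?R\<^esub> y \<in> carrier ?R"
      using Poly_Mapping.keys_add[of x y] by (auto simp: poly_ring_def)
  next
    fix x assume x: "x \<in> carrier ?R"
    show "\<exists>y\<in>carrier ?R. y \<oplus>\<^bsub>?R\<^esub> x = \<zero>\<^bsub>?R\<^esub>"
      using x by (intro bexI[of _ "- x"]) (auto simp: poly_ring_def)
  qed (auto simp: poly_ring_def add_ac)
  show "comm_monoid ?R"
  proof (rule comm_monoidI)
    fix x y assume x: "x \<in> carrier ?R" "y \<in> carrier ?R"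
    show "x \<otimes>\<^bsub>?R\<^esub> y \<in> carrier ?R"
      unfolding poly_ring_def
    proof (clarsimp)
      fix m i assume m: "m \<in> Poly_Mapping.keys (x * y)" and i: "i \<in> Poly_Mapping.keys m"
      obtain a b where ab: "m = a + b" "a \<in> Poly_Mapping.keys x" "b \<in> Poly_Mapping.keys y"
        using m Poly_Mapping.keys_mult[of x y] by blast
      have "i \<in> Poly_Mapping.keys a \<union> Poly_Mapping.keys b"
        using i ab(1) Poly_Mapping.keys_add[of a b] by blast
      then have "i \<in> {1..n}" using ab x unfolding poly_ring_def by fastforce
      then show "Suc 0 \<le> i \<and> i \<le> n" by simp
    qed
  qed (auto simp: poly_ring_def mult_ac)
  show "\<And>x y z. (x \<oplus>\<^bsub>?R\<^esub> y) \<otimes>\<^bsub>?R\<^esub> z = x \<otimes>\<^bsub>?R\<^esub> z \<oplus>\<^bsub>?R\<^esub> y \<otimes>\<^bsub>?R\<^esub> z"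
    by (simp add: poly_ring_def algebra_simps)
qed

lemma monomials_subset_carrier: "monomials n \<subseteq> carrier (poly_ring n :: 'a::field polynomial ring)"
  by (auto simp: monomials_def monomial_def poly_ring_def split: if_splits)

lemma monomial_inj: "(monomial g :: 'a::field polynomial) = monomial m \<Longrightarrow> g = m"
  unfolding monomial_def
  by (metis keys_single singleton_inject zero_neq_one)

lemma sqfree_monomial_eq:
  assumes "finite F"
  shows "sqfree_monomial F = (monomial (\<Sum>i\<in>F. Poly_Mapping.single i 1) :: 'a::field polynomial)"
  using assms
  by (induction F rule: finite_induct)
     (auto simp: sqfree_monomial_def monomial_def var_def mult_single)

lemma sqfree_monomial_mem:
  assumes "F \<subseteq> {1..n}"
  shows "(sqfree_monomial F :: 'a::field polynomial) \<in> monomials n"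
proof -
  have fin: "finite F" using assms finite_subset by blast
  have "Poly_Mapping.keys (\<Sum>i\<in>F. Poly_Mapping.single i (1::nat)) \<subseteq> F"
    using Poly_Mapping.keys_sum[of "\<lambda>i. Poly_Mapping.single i (1::nat)" F] by auto
  then show ?thesis
    using assms sqfree_monomial_eq[OF fin] unfolding monomials_def by blast
qed

lemma monomial_in_Idl:
  fixes G :: "'a::field polynomial set"
  assumes G: "G \<subseteq> monomials n" and m: "monomial m \<in> Idl\<^bsub>poly_ring n\<^esub> G"
  shows "\<exists>g d. monomial g \<in> G \<and> m = g + d \<and> Poly_Mapping.keys m \<subseteq> {1..n}"
proof -
  let ?R = "poly_ring n :: 'a polynomial ring"
  interpret cring ?R by (rule poly_ring_cring)
  define J where "J = {p \<in> carrier ?R. \<forall>m\<in>Poly_Mapping.keys p. \<exists>g d. monomial g \<in> G \<and> m = g + d}"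
  have J_mult: "q * p \<in> J" if p: "p \<in> J" and q: "q \<in> carrier ?R" for p q
  proof -
    have "q * p \<in> carrier ?R"
      using p q m_closed[of q p] by (auto simp: J_def poly_ring_def)
    moreover have "\<exists>g d. monomial g \<in> G \<and> m = g + d" if km: "m \<in> Poly_Mapping.keys (q * p)" for m
    proof -
      obtain a b where ab: "m = a + b" "a \<in> Poly_Mapping.keys q" "b \<in> Poly_Mapping.keys p"
        using km Poly_Mapping.keys_mult[of q p] by blast
      obtain g d where "monomial g \<in> G" "b = g + d" using ab p by (auto simp: J_def)
      then show ?thesis using ab by (metis add.left_commute)
    qed
    ultimately show ?thesis by (auto simp: J_def)
  qed
  have "ideal J ?R"
  proof (rule idealI)
    show "ring ?R" by (rule ring_axioms)
    show "subgroup J (add_monoid ?R)"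
    proof (rule add.subgroupI)
      show "J \<subseteq> carrier ?R" by (auto simp: J_def)
      have "0 \<in> J" by (auto simp: J_def poly_ring_def)
      then show "J \<noteq> {}" by blast
    next
      fix p assume p: "p \<in> J"
      have "- p = (\<ominus>\<^bsub>?R\<^esub> p)"
        using p by (intro minus_equality[symmetric]) (auto simp: J_def poly_ring_def)
      moreover have "Poly_Mapping.keys (- p) = Poly_Mapping.keys p"
        by (auto simp: in_keys_iff)
      ultimately show "(\<ominus>\<^bsub>?R\<^esub> p) \<in> J"
        using p by (simp add: J_def poly_ring_def)
    next
      fix p q assume pq: "p \<in> J" "q \<in> J"
      then have "p \<oplus>\<^bsub>?R\<^esub> q \<in> carrier ?R" by (simp add: J_def)
      moreover have "\<exists>g d. monomial g \<in> G \<and> m = g + d"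
        if m: "m \<in> Poly_Mapping.keys (p + q)" for m
      proof -
        have "m \<in> Poly_Mapping.keys p \<or> m \<in> Poly_Mapping.keys q"
          using m Poly_Mapping.keys_add[of p q] by blast
        then show ?thesis using pq unfolding J_def by blast
      qed
      ultimately show "p \<oplus>\<^bsub>?R\<^esub> q \<in> J"
        by (simp add: J_def poly_ring_def)
    qed
  next
    fix p q assume "p \<in> J" "q \<in> carrier ?R"
    then show "q \<otimes>\<^bsub>?R\<^esub> p \<in> J" "p \<otimes>\<^bsub>?R\<^esub> q \<in> J"
      using J_mult[of p q] by (auto simp: poly_ring_def mult.commute)
  qed
  moreover have "G \<subseteq> J"
  proof
    fix p assume p: "p \<in> G"
    then obtain g where g: "p = monomial g" using G by (auto simp: monomials_def)
    have "\<exists>h d. monomial h \<in> G \<and> m = h + d" if "m \<in> Poly_Mapping.keys p" for m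
      using that p g by (intro exI[of _ g] exI[of _ 0]) (auto simp: monomial_def)
    then show "p \<in> J"
      using p G monomials_subset_carrier[of n, where ?'a='a] by (auto simp: J_def)
  qed
  ultimately have "Idl\<^bsub>?R\<^esub> G \<subseteq> J" by (rule genideal_minimal)
  then have "monomial m \<in> J" using m by blast
  then show ?thesis by (auto simp: J_def monomial_def poly_ring_def)
qed

lemma Idl_cong_subset:
  fixes G H :: "'a::field polynomial set"
  assumes "H \<subseteq> G" "G \<subseteq> monomials n" "G \<subseteq> Idl\<^bsub>poly_ring n\<^esub> H"
  shows "Idl\<^bsub>poly_ring n\<^esub> H = Idl\<^bsub>poly_ring n\<^esub> G"
proof -
  interpret cring "poly_ring n :: 'a polynomial ring" by (rule poly_ring_cring)
  have G: "G \<subseteq> carrier (poly_ring n)" using assms(2) monomials_subset_carrier by blast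
  show ?thesis
  proof (rule antisym)
    show "Idl\<^bsub>poly_ring n\<^esub> H \<subseteq> Idl\<^bsub>poly_ring n\<^esub> G"
      using assms(1) G by (meson genideal_ideal genideal_minimal genideal_self order_trans)
    show "Idl\<^bsub>poly_ring n\<^esub> G \<subseteq> Idl\<^bsub>poly_ring n\<^esub> H"
      using assms G by (intro genideal_minimal genideal_ideal) auto
  qed
qed

lemma monomial_multiple_in_Idl:
  fixes H :: "'a::field polynomial set"
  assumes "H \<subseteq> monomials n" "monomial g \<in> H" "Poly_Mapping.keys (g + d) \<subseteq> {1..n}"
  shows "monomial (g + d) \<in> Idl\<^bsub>poly_ring n\<^esub> H"
proof -
  interpret cring "poly_ring n :: 'a polynomial ring" by (rule poly_ring_cring)
  have H: "H \<subseteq> carrier (poly_ring n)" using assms(1) monomials_subset_carrier by blast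
  have "Poly_Mapping.keys d \<subseteq> Poly_Mapping.keys (g + d)"
    by (auto simp: in_keys_iff lookup_add)
  then have "(monomial d :: 'a polynomial) \<in> carrier (poly_ring n)"
    using assms(3) by (auto simp: monomial_def poly_ring_def)
  moreover have "(monomial g :: 'a polynomial) \<in> Idl\<^bsub>poly_ring n\<^esub> H"
    using genideal_self[OF H] assms(2) by blast
  ultimately have "monomial g \<otimes>\<^bsub>poly_ring n\<^esub> monomial d \<in> Idl\<^bsub>poly_ring n\<^esub> H"
    using ideal.I_r_closed[OF genideal_ideal[OF H]] by blast
  then show ?thesis by (simp add: poly_ring_def monomial_def mult_single)
qed

lemma min_monomial_gen_set_iff:
  fixes G :: "'a::field polynomial set"
  assumes "min_monomial_gen_set n I G"
  shows "monomial m \<in> G \<longleftrightarrow>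
           monomial m \<in> I \<and> (\<forall>g d. monomial g \<in> I \<longrightarrow> m = g + d \<longrightarrow> d = 0)"
proof -
  interpret cring "poly_ring n :: 'a polynomial ring" by (rule poly_ring_cring)
  have G: "G \<subseteq> monomials n" and I: "I = Idl\<^bsub>poly_ring n\<^esub> G"
    and min: "\<And>H. H \<subset> G \<Longrightarrow> Idl\<^bsub>poly_ring n\<^esub> H \<noteq> I"
    using assms by (auto simp: min_monomial_gen_set_def)
  have GI: "G \<subseteq> I"
    using G I monomials_subset_carrier genideal_self by blast
  have anti: "d = 0" if m: "monomial m \<in> G" and g: "monomial g \<in> I" and md: "m = g + d" for m g d
  proof (rule ccontr)
    assume d: "d \<noteq> 0"
    obtain h e where h: "monomial h \<in> G" "g = h + e" using monomial_in_Idl[OF G] g I by blast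
    have ne: "h \<noteq> m"
    proof
      assume "h = m"
      then have "e + d = 0" using md h by (simp add: add.assoc)
      then have "Poly_Mapping.lookup d i = 0" for i
        by (metis add_is_0 lookup_add lookup_zero)
      then show False using d by (simp add: poly_mapping_eqI)
    qed
    define H where "H = G - {monomial m}"
    have hH: "monomial h \<in> H" using h ne monomial_inj[of h m] by (auto simp: H_def)
    have km: "Poly_Mapping.keys m \<subseteq> {1..n}" using monomial_in_Idl[OF G] m GI I by blast
    have "monomial (h + (e + d)) \<in> Idl\<^bsub>poly_ring n\<^esub> H"
      using G hH km md h by (intro monomial_multiple_in_Idl) (auto simp: H_def add.assoc)
    moreover have "H \<subseteq> Idl\<^bsub>poly_ring n\<^esub> H"
      using G monomials_subset_carrier by (intro genideal_self) (auto simp: H_def)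
    ultimately have "G \<subseteq> Idl\<^bsub>poly_ring n\<^esub> H"
      using md h by (auto simp: H_def add.assoc)
    then have "Idl\<^bsub>poly_ring n\<^esub> H = I" using Idl_cong_subset[of H G n] G I by (auto simp: H_def)
    moreover have "H \<subset> G" using m by (auto simp: H_def)
    ultimately show False using min by blast
  qed
  show ?thesis
  proof
    assume "monomial m \<in> G"
    then show "monomial m \<in> I \<and> (\<forall>g d. monomial g \<in> I \<longrightarrow> m = g + d \<longrightarrow> d = 0)"
      using anti GI by blast
  next
    assume m: "monomial m \<in> I \<and> (\<forall>g d. monomial g \<in> I \<longrightarrow> m = g + d \<longrightarrow> d = 0)"
    then obtain g d where "monomial g \<in> G" "m = g + d" using monomial_in_Idl[OF G] I by blast
    then show "monomial m \<in> G" using m GI by (metis add.right_neutral subsetD)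
  qed
qed

lemma min_monomial_gen_set_unique:
  fixes I :: "'a::field polynomial set"
  assumes "sqfree_monomial_ideal n I"
  shows "\<exists>!G. min_monomial_gen_set n I G"
proof (rule ex_ex1I)
  obtain S where S: "S \<subseteq> {sqfree_monomial F | F. F \<subseteq> {1..n}}" "I = Idl\<^bsub>poly_ring n\<^esub> S"
    using assms by (auto simp: sqfree_monomial_ideal_def)
  have finS: "finite S"
  proof (rule finite_subset[OF S(1)])
    have "{sqfree_monomial F | F. F \<subseteq> {1..n}} = (sqfree_monomial ` Pow {1..n} :: 'a polynomial set)"
      by auto
    then show "finite {sqfree_monomial F :: 'a polynomial | F. F \<subseteq> {1..n}}" by simp
  qed
  define A where "A = {H. H \<subseteq> S \<and> Idl\<^bsub>poly_ring n\<^esub> H = I}"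
  have "finite A" "A \<noteq> {}" using finS S(2) by (auto simp: A_def)
  from finite_has_minimal[OF this]
  obtain G where G: "G \<in> A" "\<forall>H\<in>A. H \<subseteq> G \<longrightarrow> G = H" by (elim bexE)
  have sub: "G \<subseteq> monomials n"
  proof
    fix p assume "p \<in> G"
    then obtain F where "p = sqfree_monomial F" "F \<subseteq> {1..n}" using G(1) S(1) unfolding A_def by blast
    then show "p \<in> monomials n" using sqfree_monomial_mem by simp
  qed
  have min: "Idl\<^bsub>poly_ring n\<^esub> H \<noteq> I" if "H \<subset> G" for H
    using G that unfolding A_def by blast
  have "min_monomial_gen_set n I G"
    unfolding min_monomial_gen_set_def using G(1) sub min unfolding A_def by blast
  then show "\<exists>G. min_monomial_gen_set n I G" ..
next
  fix G H assume GH: "min_monomial_gen_set n I G" "min_monomial_gen_set n I H"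
  then have "G \<subseteq> monomials n" "H \<subseteq> monomials n" by (auto simp: min_monomial_gen_set_def)
  moreover have "monomial m \<in> G \<longleftrightarrow> monomial m \<in> H" for m
    using min_monomial_gen_set_iff[OF GH(1)] min_monomial_gen_set_iff[OF GH(2)] by blast
  ultimately show "G = H" unfolding monomials_def by blast
qed

end

theory Submission
  imports Defs "HOL-Library.Ramsey"
begin

text \<open>
  Let \<open>E\<close>, \<open>N\<close>, \<open>T\<close> be the families of vertex sets behind \<open>G1\<close>, \<open>NF\<close> and
  \<open>G2 \<union> G3 \<union> G4\<close>.  No pair in \<open>E\<close> lies in a triple of \<open>T\<close>, so these monomials are the minimal
  generators of \<open>I\<close>; hence the faces of the Stanley-Reisner complex are the sets containing no
  member of \<open>E \<union> T\<close>, and the faces of the facet complex are the sets contained in such a member.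
  Comparing the two \<open>f\<close>-vectors is then a matter of counting, size by size
  (\<open>f_ideal_of_pairs_and_triples\<close>).

  \<^item> Size at least 4: the facet complex has no such face.  Neither has the Stanley-Reisner complex,
    because two even vertices form a pair in \<open>E\<close>, three odd vertices up to \<open>2k\<close> a triple from \<open>G3\<close>,
    and two odd vertices together with the apex \<open>2k + 1\<close> a triple from \<open>G2\<close>, and one of these three
    patterns occurs among any four vertices (\<open>four_set_contains_generator\<close>).
  \<^item> Size 2: the Stanley-Reisner complex misses exactly the pairs in \<open>E\<close>.  The facet complex misses
    exactly those in \<open>N\<close>: \<open>G2\<close> puts every pair inside \<open>{1..2k}\<close> that is in neither \<open>E\<close> nor \<open>N\<close>
    into a triple with the apex (\<open>uncovered_pairs_eq_nonedges\<close>).  Both \<open>E\<close> and \<open>N\<close> consist of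
    \<open>(k choose 2) + 2\<close> pairs.
  \<^item> Size 3: the faces of the facet complex are the members of \<open>T\<close>, those of the Stanley-Reisner
    complex are the triples without a pair in \<open>E\<close> that are not in \<open>T\<close>.  So \<open>T\<close> has to comprise
    exactly half of the triples without a pair in \<open>E\<close>, of which there are
    \<open>(4k\<^sup>3 + 3k\<^sup>2 - 13k + 6) / 6\<close> (\<open>card_edge_free_triples\<close>).  As \<open>G2\<close> and \<open>G3\<close> contribute
    \<open>k\<^sup>2 - 4\<close> and \<open>k choose 3\<close> triples, the prescribed size of \<open>G4\<close> is what is left; any
    triples that are new and contain no pair in \<open>E\<close> or \<open>N\<close> will do.
\<close>

section \<open>Squarefree monomials and the ideals they generate\<close>

abbreviation indicator_exponent :: "nat set \<Rightarrow> nat \<Rightarrow>\<^sub>0 nat" where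
  "indicator_exponent F \<equiv> \<Sum>i\<in>F. Poly_Mapping.single i 1"

lemma lookup_indicator_exponent:
  assumes "finite F"
  shows "Poly_Mapping.lookup (indicator_exponent F) i = (if i \<in> F then 1 else 0)"
  using assms by (simp add: lookup_sum lookup_single when_def)

lemma keys_indicator_exponent:
  assumes "finite F"
  shows "Poly_Mapping.keys (indicator_exponent F) = F"
  unfolding keys.rep_eq lookup_indicator_exponent[OF assms] by simp

lemma mdegree_indicator_exponent:
  assumes "finite F"
  shows "mdegree (indicator_exponent F) = card F"
proof -
  have "mdegree (indicator_exponent F) = (\<Sum>i\<in>F. 1)"
    unfolding mdegree_def keys_indicator_exponent[OF assms]
    by (rule sum.cong) (simp_all only: lookup_indicator_exponent[OF assms] if_True)
  then show ?thesis by simp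
qed

lemma indicator_exponent_add_imp_subset:
  assumes "finite F" "finite H" "indicator_exponent H = indicator_exponent F + d"
  shows "F \<subseteq> H"
proof
  fix i assume "i \<in> F"
  then have "Poly_Mapping.lookup (indicator_exponent H) i \<noteq> 0"
    unfolding assms(3) lookup_add lookup_indicator_exponent[OF assms(1)] by simp
  then show "i \<in> H"
    unfolding lookup_indicator_exponent[OF assms(2)] by (simp split: if_splits)
qed

lemma sqfree_monomial_dvd_iff:
  assumes "finite F" "finite H"
  shows "(sqfree_monomial F :: 'a::field polynomial) dvd sqfree_monomial H \<longleftrightarrow> F \<subseteq> H"
proof
  assume "(sqfree_monomial F :: 'a polynomial) dvd sqfree_monomial H"
  then obtain q :: "'a polynomial"
    where "sqfree_monomial H = sqfree_monomial F * q" by (elim dvdE)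
  then have eq: "monomial (indicator_exponent H) = monomial (indicator_exponent F) * q"
    using assms by (simp add: sqfree_monomial_eq)
  have "indicator_exponent H \<in> Poly_Mapping.keys (monomial (indicator_exponent H) :: 'a polynomial)"
    by (simp add: monomial_def)
  then obtain a b where
    ab: "indicator_exponent H = a + b"
        "a \<in> Poly_Mapping.keys (monomial (indicator_exponent F) :: 'a polynomial)"
    unfolding eq using Poly_Mapping.keys_mult by blast
  from ab(2) have "a = indicator_exponent F" by (simp add: monomial_def)
  with ab(1) assms show "F \<subseteq> H" by (metis indicator_exponent_add_imp_subset)
next
  assume "F \<subseteq> H"
  then show "(sqfree_monomial F :: 'a polynomial) dvd sqfree_monomial H"
    unfolding sqfree_monomial_def using assms(2) by (intro prod_dvd_prod_subset)
qed

lemma sqfree_monomial_inj: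
  assumes "finite F" "finite H"
    and "(sqfree_monomial F :: 'a::field polynomial) = sqfree_monomial H"
  shows "F = H"
  using assms sqfree_monomial_dvd_iff[of F H, where ?'a='a] sqfree_monomial_dvd_iff[of H F, where ?'a='a]
  by auto

lemma sqfree_monomial_image_subset_monomials:
  assumes "S \<subseteq> Pow {1..n}"
  shows "(sqfree_monomial ` S :: 'a::field polynomial set) \<subseteq> monomials n"
proof
  fix p :: "'a polynomial" assume "p \<in> sqfree_monomial ` S"
  then obtain s where "s \<in> S" "p = sqfree_monomial s" by blast
  then show "p \<in> monomials n" using assms sqfree_monomial_mem[of s n] by auto
qed

lemma sqfree_monomial_mem_Idl_iff:
  assumes S: "S \<subseteq> Pow {1..n}" and F: "F \<subseteq> {1..n}"
  shows "(sqfree_monomial F :: 'a::field polynomial) \<in> Idl\<^bsub>poly_ring n\<^esub> (sqfree_monomial ` S)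
           \<longleftrightarrow> (\<exists>s\<in>S. s \<subseteq> F)"
proof
  let ?G = "sqfree_monomial ` S :: 'a polynomial set"
  note finF = finite_subset[OF F finite_atLeastAtMost]
  assume "(sqfree_monomial F :: 'a polynomial) \<in> Idl\<^bsub>poly_ring n\<^esub> ?G"
  then have "(monomial (indicator_exponent F) :: 'a polynomial) \<in> Idl\<^bsub>poly_ring n\<^esub> ?G"
    by (simp add: sqfree_monomial_eq[OF finF])
  from monomial_in_Idl[OF sqfree_monomial_image_subset_monomials[OF S] this]
  obtain g d where g: "(monomial g :: 'a polynomial) \<in> ?G" "indicator_exponent F = g + d" by auto
  then obtain s where s: "s \<in> S" "(monomial g :: 'a polynomial) = sqfree_monomial s" by auto
  have fins: "finite s" using S s(1) finite_subset[of s "{1..n}"] by auto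
  have "g = indicator_exponent s"
    using s(2) monomial_inj unfolding sqfree_monomial_eq[OF fins] by blast
  then have "s \<subseteq> F" using indicator_exponent_add_imp_subset[OF fins finF] g(2) by simp
  with s(1) show "\<exists>s\<in>S. s \<subseteq> F" by blast
next
  let ?G = "sqfree_monomial ` S :: 'a polynomial set"
  note finF = finite_subset[OF F finite_atLeastAtMost]
  assume "\<exists>s\<in>S. s \<subseteq> F"
  then obtain s where s: "s \<in> S" "s \<subseteq> F" by blast
  have fins: "finite s" using s(2) finF finite_subset by blast
  have split: "indicator_exponent F = indicator_exponent s + indicator_exponent (F - s)"
    using sum.subset_diff[OF s(2) finF] by (simp add: add.commute)
  have "(monomial (indicator_exponent s + indicator_exponent (F - s)) :: 'a polynomial)
          \<in> Idl\<^bsub>poly_ring n\<^esub> ?G"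
  proof (rule monomial_multiple_in_Idl[OF sqfree_monomial_image_subset_monomials[OF S]])
    show "monomial (indicator_exponent s) \<in> ?G"
      using s(1) sqfree_monomial_eq[OF fins, where ?'a='a] by force
    show "Poly_Mapping.keys (indicator_exponent s + indicator_exponent (F - s)) \<subseteq> {1..n}"
      using F unfolding split[symmetric] keys_indicator_exponent[OF finF] .
  qed
  then show "(sqfree_monomial F :: 'a polynomial) \<in> Idl\<^bsub>poly_ring n\<^esub> ?G"
    unfolding sqfree_monomial_eq[OF finF] split .
qed

lemma sqfree_monomial_ideal_Idl:
  assumes "S \<subseteq> Pow {1..n}"
  shows "sqfree_monomial_ideal n (Idl\<^bsub>poly_ring n\<^esub> (sqfree_monomial ` S :: 'a::field polynomial set))"
  unfolding sqfree_monomial_ideal_def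
proof (intro exI[of _ "sqfree_monomial ` S"] conjI)
  show "sqfree_monomial ` S \<subseteq> {sqfree_monomial F :: 'a polynomial |F. F \<subseteq> {1..n}}"
    using assms by auto
qed (rule refl)

text \<open>
  Without divisibilities between its members, a generating set cannot be shrunk: a monomial lies
  in the ideal of the remaining ones only if one of them divides it.
\<close>

lemma min_gens_antichain:
  assumes S: "S \<subseteq> Pow {1..n}"
    and anti: "\<And>s t. s \<in> S \<Longrightarrow> t \<in> S \<Longrightarrow> s \<subseteq> t \<Longrightarrow> s = t"
  shows "min_gens n (Idl\<^bsub>poly_ring n\<^esub> (sqfree_monomial ` S)) =
           (sqfree_monomial ` S :: 'a::field polynomial set)"
proof -
  let ?G = "sqfree_monomial ` S :: 'a polynomial set"
  let ?I = "Idl\<^bsub>poly_ring n\<^esub> ?G"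
  have irredundant: "Idl\<^bsub>poly_ring n\<^esub> H \<noteq> ?I" if "H \<subset> ?G" for H
  proof
    assume eq: "Idl\<^bsub>poly_ring n\<^esub> H = ?I"
    define S' where "S' = {s \<in> S. sqfree_monomial s \<in> H}"
    have S': "S' \<subseteq> S" "H = sqfree_monomial ` S'" using that by (auto simp: S'_def)
    from that obtain s where s: "s \<in> S" "sqfree_monomial s \<notin> H" by blast
    have sV: "s \<subseteq> {1..n}" and S'V: "S' \<subseteq> Pow {1..n}" using S S'(1) s(1) by auto
    have "sqfree_monomial s \<in> ?I"
      unfolding sqfree_monomial_mem_Idl_iff[OF S sV] using s(1) by blast
    then have "\<exists>t\<in>S'. t \<subseteq> s"
      unfolding eq[symmetric] S'(2) sqfree_monomial_mem_Idl_iff[OF S'V sV] .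
    then have "s \<in> S'" using anti s(1) S'(1) by blast
    then show False using s(2) S'(2) by blast
  qed
  have unique: "\<exists>!G. min_monomial_gen_set n ?I G"
    by (rule min_monomial_gen_set_unique[OF sqfree_monomial_ideal_Idl[OF S]])
  have "min_monomial_gen_set n ?I ?G"
    unfolding min_monomial_gen_set_def
    using sqfree_monomial_image_subset_monomials[OF S] irredundant by blast
  then show ?thesis unfolding min_gens_def by (rule the1_equality[OF unique])
qed

section \<open>A numerical criterion for generation in degrees two and three\<close>

lemma nsets_1_to_eq: "nsets {1..n} j = {F. F \<subseteq> {1..n::nat} \<and> card F = j}"
  by (auto simp: nsets_def intro: finite_subset[OF _ finite_atLeastAtMost])

text \<open>
  An \<open>f\<close>-vector is a list as long as the largest face requires, so comparing its entries is only
  enough once both complexes are known to have the same dimension.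
\<close>

lemma f_vector_eqI:
  assumes "\<forall>F\<in>\<Delta>. card F \<le> d" "\<forall>F\<in>\<Gamma>. card F \<le> d"
    and "F\<^sub>0 \<in> \<Delta>" "card F\<^sub>0 = d" "F\<^sub>1 \<in> \<Gamma>" "card F\<^sub>1 = d"
    and counts: "\<And>j. j \<le> d \<Longrightarrow> card {F \<in> \<Delta>. card F = j} = card {F \<in> \<Gamma>. card F = j}"
  shows "f_vector \<Delta> = f_vector \<Gamma>"
proof -
  have top: "Max (card ` X) = d"
    if le: "\<forall>F\<in>X. card F \<le> d" and mem: "F \<in> X" "card F = d" for X :: "nat set set" and F
  proof (rule Max_eqI)
    show "finite (card ` X)" by (rule finite_subset[of _ "{..d}"]) (use le in auto)
    show "d \<in> card ` X" using mem by auto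
  qed (use le in auto)
  have "Max (card ` \<Delta>) = d" by (rule top[OF assms(1,3,4)])
  moreover have "Max (card ` \<Gamma>) = d" by (rule top[OF assms(2,5,6)])
  moreover have "\<Delta> \<noteq> {}" "\<Gamma> \<noteq> {}" using assms(3,5) by auto
  ultimately show ?thesis unfolding f_vector_def by (simp add: counts del: upt_Suc)
qed

text \<open>
  Once every vertex lies in a generator and every four-set contains one, the two complexes can only
  differ in the number of faces of size 2 and 3.  The hypothesis \<open>pairs\<close> balances the non-faces of size 2 of the two complexes.  For size 3, the
  edge-free triples are split by \<open>T\<close> into the faces of the facet complex and the faces of the
  Stanley-Reisner complex, which are equally many if and only if \<open>triples\<close> holds.
\<close>

lemma f_ideal_of_pairs_and_triples:
  fixes E T :: "nat set set"
  assumes E: "E \<subseteq> nsets {1..n} 2" and T: "T \<subseteq> nsets {1..n} 3" and "T \<noteq> {}"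
    and anti: "\<And>e t. e \<in> E \<Longrightarrow> t \<in> T \<Longrightarrow> \<not> e \<subseteq> t"
    and four: "\<And>F. F \<in> nsets {1..n} 4 \<Longrightarrow> \<exists>s\<in>E \<union> T. s \<subseteq> F"
    and vertex: "\<And>v. v \<in> {1..n} \<Longrightarrow> \<exists>s\<in>E \<union> T. v \<in> s"
    and pairs: "card {p \<in> nsets {1..n} 2. \<not> (\<exists>s\<in>E \<union> T. p \<subseteq> s)} = card E"
    and triples: "card {t \<in> nsets {1..n} 3. \<not> (\<exists>e\<in>E. e \<subseteq> t)} = 2 * card T"
  shows "f_ideal n (Idl\<^bsub>poly_ring n\<^esub> (sqfree_monomial ` (E \<union> T) :: 'a::field polynomial set))"
proof -
  let ?S = "E \<union> T"
  let ?I = "Idl\<^bsub>poly_ring n\<^esub> (sqfree_monomial ` ?S :: 'a polynomial set)"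
  have S: "?S \<subseteq> Pow {1..n}" using E T by (auto simp: nsets_def)
  have fin: "finite s" if "s \<in> ?S" for s using that E T by (auto simp: nsets_def)
  have card_S: "card s = 2 \<or> card s = 3" if "s \<in> ?S" for s
    using that E T by (auto simp: nsets_def)
  have eq_if_card: "s = t" if "s \<in> ?S" "t \<in> ?S" "s \<subseteq> t" "card s = card t" for s t
    using that fin card_subset_eq by blast
  have antichain: "s = t" if "s \<in> ?S" "t \<in> ?S" "s \<subseteq> t" for s t
  proof -
    have "card s \<le> card t" using that fin card_mono by blast
    moreover have "\<not> (card s = 2 \<and> card t = 3)"
    proof
      assume "card s = 2 \<and> card t = 3"
      then have "s \<in> E" "t \<in> T" using that E T by (auto simp: nsets_def)
      then show False using anti that(3) by blast
    qed
    ultimately have "card s = card t" using card_S[OF that(1)] card_S[OF that(2)] by auto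
    then show ?thesis using eq_if_card that by blast
  qed
  have gens: "min_gens n ?I = sqfree_monomial ` ?S"
    by (rule min_gens_antichain[OF S antichain])
  define \<Delta> where "\<Delta> = {F. F \<subseteq> {1..n} \<and> \<not> (\<exists>s\<in>?S. s \<subseteq> F)}"
  define \<Gamma> where "\<Gamma> = {F. F \<subseteq> {1..n} \<and> (\<exists>s\<in>?S. F \<subseteq> s)}"
  have SR: "stanley_reisner_complex n ?I = \<Delta>"
    unfolding stanley_reisner_complex_def \<Delta>_def
    by (intro Collect_cong conj_cong refl) (simp only: sqfree_monomial_mem_Idl_iff[OF S])
  have FC: "facet_complex n ?I = \<Gamma>"
  proof -
    have "(sqfree_monomial F :: 'a polynomial) dvd sqfree_monomial s \<longleftrightarrow> F \<subseteq> s"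
      if "F \<subseteq> {1..n}" "s \<in> ?S" for F s
      using sqfree_monomial_dvd_iff[OF finite_subset[OF that(1) finite_atLeastAtMost] fin[OF that(2)]] .
    then show ?thesis
      unfolding facet_complex_def gens \<Gamma>_def
      by (intro Collect_cong conj_cong refl) (simp add: bex_Un)
  qed
  have faces: "{F \<in> \<Delta>. card F = j} = {F \<in> nsets {1..n} j. \<not> (\<exists>s\<in>?S. s \<subseteq> F)}"
    "{F \<in> \<Gamma>. card F = j} = {F \<in> nsets {1..n} j. \<exists>s\<in>?S. F \<subseteq> s}" for j
    unfolding nsets_1_to_eq \<Delta>_def \<Gamma>_def by auto
  have finV: "finite (nsets {1..n} j)" for j by (simp add: finite_imp_finite_nsets)
  \<comment> \<open>A set with fewer than two elements contains no generator, and it lies in one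
    because every vertex does.\<close>
  have low: "{F \<in> \<Delta>. card F = j} = {F \<in> \<Gamma>. card F = j}" if "j < 2" for j
  proof -
    have "\<not> (\<exists>s\<in>?S. s \<subseteq> F)" if "F \<in> nsets {1..n} j" for F
    proof
      assume "\<exists>s\<in>?S. s \<subseteq> F"
      then obtain s where s: "s \<in> ?S" "s \<subseteq> F" by blast
      then have "card s \<le> card F" using that by (intro card_mono) (auto simp: nsets_def)
      then show False using card_S[OF s(1)] that \<open>j < 2\<close> by (auto simp: nsets_def)
    qed
    moreover have "\<exists>s\<in>?S. F \<subseteq> s" if "F \<in> nsets {1..n} j" for F
    proof (cases "F = {}")
      case True
      then show ?thesis using \<open>T \<noteq> {}\<close> by blast
    next
      case False
      have "finite F" "card F < 2" using that \<open>j < 2\<close> by (auto simp: nsets_def)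
      with False obtain v where "F = {v}"
        by (metis card_1_singletonE card_0_eq less_2_cases One_nat_def)
      then show ?thesis using that vertex[of v] by (auto simp: nsets_def)
    qed
    ultimately show ?thesis unfolding faces by blast
  qed
  have two: "card {F \<in> \<Delta>. card F = 2} = card {F \<in> \<Gamma>. card F = 2}"
  proof -
    have "\<not> (\<exists>s\<in>?S. s \<subseteq> p) \<longleftrightarrow> p \<notin> E" if p: "p \<in> nsets {1..n} 2" for p
    proof -
      have "s \<in> E \<and> s = p" if s: "s \<in> ?S" "s \<subseteq> p" for s
      proof -
        have "card s \<le> 2" using p s card_mono[of p s] by (auto simp: nsets_def)
        then have "card s = 2" using card_S[OF s(1)] by auto
        then show ?thesis
          using p s T card_subset_eq[of p s] by (auto simp: nsets_def)
      qed
      then show ?thesis by blast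
    qed
    then have "{F \<in> \<Delta>. card F = 2} = nsets {1..n} 2 - E" unfolding faces by blast
    then have "card {F \<in> \<Delta>. card F = 2} = card (nsets {1..n} 2) - card E"
      using E finite_subset[OF E finV] by (simp add: card_Diff_subset)
    moreover have "{F \<in> \<Gamma>. card F = 2} =
        nsets {1..n} 2 - {p \<in> nsets {1..n} 2. \<not> (\<exists>s\<in>?S. p \<subseteq> s)}"
      unfolding faces by blast
    then have "card {F \<in> \<Gamma>. card F = 2} = card (nsets {1..n} 2) - card E"
      using finV[of 2] pairs by (simp add: card_Diff_subset)
    ultimately show ?thesis by simp
  qed
  let ?free = "{t \<in> nsets {1..n} 3. \<not> (\<exists>e\<in>E. e \<subseteq> t)}"
  have eq_T: "s = t" if "s \<in> T" "t \<in> nsets {1..n} 3" "s \<subseteq> t" for s t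
    using that T card_subset_eq[of t s] by (auto simp: nsets_def)
  have \<Gamma>3: "{F \<in> \<Gamma>. card F = 3} = T"
  proof -
    have "F \<in> T" if F: "F \<in> nsets {1..n} 3" "s \<in> ?S" "F \<subseteq> s" for F s
    proof -
      have "3 \<le> card s" using F card_mono[OF fin[OF F(2)] F(3)] by (auto simp: nsets_def)
      then have c: "card s = card F" using card_S[OF F(2)] F(1) by (auto simp: nsets_def)
      then have "F = s" using F(3) fin[OF F(2)] card_subset_eq[of s F] by auto
      then show ?thesis using F E by (auto simp: nsets_def)
    qed
    then show ?thesis unfolding faces using T by blast
  qed
  have \<Delta>3: "{F \<in> \<Delta>. card F = 3} = ?free - T"
    unfolding faces using eq_T by blast
  have card\<Delta>3: "card {F \<in> \<Delta>. card F = 3} = card T"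
  proof -
    have "T \<subseteq> ?free" using T anti by blast
    moreover have "finite T" using T finV finite_subset by blast
    ultimately have "card (?free - T) = card ?free - card T" by (simp add: card_Diff_subset)
    then show ?thesis unfolding \<Delta>3 triples by simp
  qed
  have "finite T" using T finV finite_subset by blast
  with \<open>T \<noteq> {}\<close> have "card T > 0" by (simp add: card_gt_0_iff)
  then have "{F \<in> \<Delta>. card F = 3} \<noteq> {}" using card\<Delta>3 by (metis card.empty less_irrefl)
  then obtain F\<^sub>0 where F\<^sub>0: "F\<^sub>0 \<in> \<Delta>" "card F\<^sub>0 = 3" by blast
  obtain F\<^sub>1 where F\<^sub>1: "F\<^sub>1 \<in> \<Gamma>" "card F\<^sub>1 = 3" using \<open>T \<noteq> {}\<close> \<Gamma>3 by blast
  have le\<Delta>: "\<forall>F\<in>\<Delta>. card F \<le> 3"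
  proof (rule ballI, rule ccontr)
    fix F assume F: "F \<in> \<Delta>"
    assume "\<not> card F \<le> 3"
    then obtain K where K: "K \<subseteq> F" "card K = 4"
      using obtain_subset_with_card_n[of 4 F] by auto
    with F have "K \<in> nsets {1..n} 4" unfolding nsets_1_to_eq \<Delta>_def by auto
    from four[OF this] obtain s where "s \<in> ?S" "s \<subseteq> K" by (elim bexE)
    with K(1) have "s \<in> ?S" "s \<subseteq> F" by auto
    with F show False unfolding \<Delta>_def by blast
  qed
  have le\<Gamma>: "\<forall>F\<in>\<Gamma>. card F \<le> 3"
  proof
    fix F assume F: "F \<in> \<Gamma>"
    from F obtain s where s: "s \<in> ?S" "F \<subseteq> s" unfolding \<Gamma>_def by blast
    then have "card F \<le> card s" using fin card_mono by blast
    then show "card F \<le> 3" using card_S[OF s(1)] by auto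
  qed
  have "f_vector \<Delta> = f_vector \<Gamma>"
  proof (rule f_vector_eqI[OF le\<Delta> le\<Gamma> F\<^sub>0 F\<^sub>1])
    fix j :: nat assume "j \<le> 3"
    then consider "j < 2" | "j = 2" | "j = 3" by linarith
    then show "card {F \<in> \<Delta>. card F = j} = card {F \<in> \<Gamma>. card F = j}"
      by cases (use low two card\<Delta>3 \<Gamma>3 in auto)
  qed
  moreover have "2 \<le> mdegree m" if m: "monomial m \<in> min_gens n ?I" for m
  proof -
    from m obtain s where s: "s \<in> ?S" "(monomial m :: 'a polynomial) = sqfree_monomial s"
      unfolding gens by auto
    then have "m = indicator_exponent s"
      using monomial_inj fin unfolding sqfree_monomial_eq[OF fin[OF s(1)]] by blast
    then have "mdegree m = card s" by (simp only: mdegree_indicator_exponent[OF fin[OF s(1)]])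
    then show ?thesis using card_S[OF s(1)] by auto
  qed
  ultimately show ?thesis
    unfolding f_ideal_def SR FC using sqfree_monomial_ideal_Idl[OF S, where ?'a='a] by blast
qed

section \<open>The combinatorics of the family\<close>

text \<open>
  The pairs of \<open>edges\<close> generate the ideal in degree two, and those of \<open>nonedges\<close> are kept out of
  the facet complex; all other pairs inside \<open>{1..2k}\<close> become bases of a cone with apex \<open>2k + 1\<close>.
\<close>

definition edges :: "nat \<Rightarrow> nat set set" where
  "edges k = nsets {i \<in> {1..2 * k}. even i} 2 \<union> {{2, 3}, {2, 5}}"

definition nonedges :: "nat \<Rightarrow> nat set set" where
  "nonedges k = {{i, j} | i j. odd i \<and> even j \<and> i + 1 < j \<and> j \<le> 2 * k} \<union> {{2, 7}, {2, 9}}"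

definition cone_triples :: "nat \<Rightarrow> nat set set" where
  "cone_triples k = insert (2 * k + 1) ` (nsets {1..2 * k} 2 - (edges k \<union> nonedges k))"

definition odd_triples :: "nat \<Rightarrow> nat set set" where
  "odd_triples k = nsets {i \<in> {1..2 * k}. odd i} 3"

lemma edges_iff:
  assumes "i < j"
  shows "{i, j} \<in> edges k \<longleftrightarrow>
           even i \<and> even j \<and> 1 \<le> i \<and> j \<le> 2 * k \<or> (i, j) = (2, 3) \<or> (i, j) = (2, 5)"
  using assms unfolding edges_def by (auto simp: doubleton_eq_iff)

lemma nonedges_iff:
  assumes "i < j"
  shows "{i, j} \<in> nonedges k \<longleftrightarrow>
           odd i \<and> even j \<and> i + 1 < j \<and> j \<le> 2 * k \<or> (i, j) = (2, 7) \<or> (i, j) = (2, 9)"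
proof -
  have "{i, j} \<in> {{i, j} | i j. odd i \<and> even j \<and> i + 1 < j \<and> j \<le> 2 * k} \<longleftrightarrow>
          odd i \<and> even j \<and> i + 1 < j \<and> j \<le> 2 * k"
    using assms by (auto simp: doubleton_eq_iff)
  moreover have "{i, j} \<in> {{2, 7}, {2, 9}} \<longleftrightarrow> (i, j) = (2, 7) \<or> (i, j) = (2, 9)"
    using assms by (auto simp: doubleton_eq_iff)
  ultimately show ?thesis unfolding nonedges_def by blast
qed

lemma ordered_pairE:
  fixes A :: "nat set"
  assumes "p \<in> nsets A 2"
  obtains i j where "p = {i, j}" "i < j" "i \<in> A" "j \<in> A"
  using assms unfolding ordered_nsets_2_eq by auto

lemma edges_subset:
  assumes "5 \<le> k" shows "edges k \<subseteq> nsets {1..2 * k} 2"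
  using assms by (auto simp: edges_def nsets_def)

lemma nonedges_subset:
  assumes "5 \<le> k" shows "nonedges k \<subseteq> nsets {1..2 * k} 2"
proof
  fix p assume "p \<in> nonedges k"
  then consider i j where "p = {i, j}" "odd i" "i + 1 < j" "j \<le> 2 * k" | "p = {2, 7}" | "p = {2, 9}"
    unfolding nonedges_def by blast
  then show "p \<in> nsets {1..2 * k} 2" by cases (use assms in \<open>auto elim: oddE\<close>)
qed

lemma edges_nonedges_disjoint:
  assumes "5 \<le> k" shows "edges k \<inter> nonedges k = {}"
proof -
  have False if "p \<in> edges k" "p \<in> nonedges k" for p
  proof -
    from that(1) edges_subset[OF assms] have "p \<in> nsets {1..2 * k} 2" by blast
    then obtain i j where "p = {i, j}" "i < j" by (elim ordered_pairE)
    with that show False using edges_iff[of i j k] nonedges_iff[of i j k] by auto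
  qed
  then show ?thesis by blast
qed

text \<open>
  Used in contrapositive form: pairs of odd vertices are neither edges nor non-edges, which makes
  them available as bases of cone triples.
\<close>

lemma even_in_edge_or_nonedge:
  assumes "p \<in> edges k \<union> nonedges k" shows "\<exists>i\<in>p. even i"
proof -
  from assms consider "p \<in> nsets {i \<in> {1..2 * k}. even i} 2" | "2 \<in> p"
    | i j where "p = {i, j}" "even j"
    unfolding edges_def nonedges_def by blast
  then show ?thesis
  proof cases
    case 1
    then obtain i j where "p = {i, j}" "even i" by (elim ordered_pairE) simp
    then show ?thesis by blast
  next
    case 2
    then show ?thesis by (rule bexI[rotated]) simp
  next
    case (3 i j)
    then show ?thesis by simp
  qed
qed

section \<open>Counting pairs and triples\<close>

lemma card_evens: "card {i \<in> {1..2 * k}. even i} = k"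
proof -
  have "{i \<in> {1..2 * k}. even i} = (\<lambda>i. 2 * i) ` {1..k}" by (auto elim!: evenE)
  then show ?thesis by (simp add: card_image inj_on_def)
qed

lemma card_odds: "card {i \<in> {1..2 * k}. odd i} = k"
proof -
  have eq: "{i \<in> {1..2 * k}. odd i} = {1..2 * k} - {i \<in> {1..2 * k}. even i}" by auto
  have "card {i \<in> {1..2 * k}. odd i} = card {1..2 * k} - card {i \<in> {1..2 * k}. even i}"
    unfolding eq by (rule card_Diff_subset) auto
  then show ?thesis unfolding card_evens by simp
qed

lemma card_odds_Suc: "card {i \<in> {1..2 * k + 1}. odd i} = k + 1"
proof -
  have "{i \<in> {1..2 * k + 1}. odd i} = insert (2 * k + 1) {i \<in> {1..2 * k}. odd i}"
    by (auto simp: le_Suc_eq)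
  then show ?thesis using card_odds[of k] by simp
qed

lemma card_edges: "card (edges k) = (k choose 2) + 2"
proof -
  have fin: "finite (nsets {i \<in> {1..2 * k}. even i} 2)"
    by (intro finite_imp_finite_nsets) simp
  have disj: "nsets {i \<in> {1..2 * k}. even i} 2 \<inter> {{2, 3}, {2, 5}} = {}" by auto
  moreover have "card {{2, 3}, {2, 5 :: nat}} = 2" by (simp add: doubleton_eq_iff)
  ultimately show ?thesis
    unfolding edges_def
    by (subst card_Un_disjoint[OF fin _ disj]) (simp_all only: card_nsets card_evens finite.intros)
qed

text \<open>
  Writing the odd vertex as \<open>2a - 1\<close> and the even one as \<open>2b\<close>, the condition \<open>i + 1 < j\<close> becomes
  \<open>a < b\<close>.  So, apart from the two exceptional pairs, the non-edges correspond to the pairs in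
  \<open>{1..k}\<close>, exactly as the pairs of even vertices do.
\<close>

lemma card_nonedges: "card (nonedges k) = (k choose 2) + 2"
proof -
  let ?N = "{{i, j} | i j. odd i \<and> even j \<and> i + 1 < j \<and> j \<le> 2 * k}"
  let ?f = "\<lambda>A. {2 * Min A - 1, 2 * Max A} :: nat set"
  let ?P = "nsets {1..k} 2"
  have f: "?f {a, b} = {2 * a - 1, 2 * b}" if "a < b" for a b using that by simp
  have fin: "finite ?P" by (simp add: finite_imp_finite_nsets)
  have img: "?N = ?f ` ?P"
  proof
    show "?N \<subseteq> ?f ` ?P"
    proof
      fix p assume "p \<in> ?N"
      then obtain i j where p: "p = {i, j}" "odd i" "even j" "i + 1 < j" "j \<le> 2 * k" by blast
      then obtain a b where ab: "i = 2 * a + 1" "j = 2 * b" by (auto elim!: oddE evenE)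
      have "a + 1 < b" "b \<le> k" using p ab by auto
      then have "{a + 1, b} \<in> ?P" "p = ?f {a + 1, b}" using p(1) ab f[of "a + 1" b] by auto
      then show "p \<in> ?f ` ?P" by (rule image_eqI[rotated])
    qed
    show "?f ` ?P \<subseteq> ?N"
    proof
      fix p assume "p \<in> ?f ` ?P"
      then obtain A where A: "A \<in> ?P" "p = ?f A" by blast
      then obtain a b where ab: "A = {a, b}" "a < b" "a \<in> {1..k}" "b \<in> {1..k}"
        by (elim ordered_pairE)
      then have "p = {2 * a - 1, 2 * b}" using A f by simp
      moreover have "odd (2 * a - 1)" using ab by simp
      moreover have "2 * a - 1 + 1 < 2 * b" "2 * b \<le> 2 * k" using ab by auto
      moreover have "even (2 * b)" by simp
      ultimately show "p \<in> ?N" by blast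
    qed
  qed
  have "inj_on ?f ?P"
  proof (rule inj_onI)
    fix A B assume AB: "A \<in> ?P" "B \<in> ?P" "?f A = ?f B"
    obtain a b where ab: "A = {a, b}" "a < b" "a \<in> {1..k}" using AB(1) by (elim ordered_pairE)
    obtain c d where cd: "B = {c, d}" "c < d" "c \<in> {1..k}" using AB(2) by (elim ordered_pairE)
    have "{2 * a - 1, 2 * b} = {2 * c - 1, 2 * d}" using AB(3) f ab cd by simp
    then have "a = c \<and> b = d" using ab cd by (auto simp: doubleton_eq_iff)
    then show "A = B" using ab cd by simp
  qed
  then have N: "card ?N = (k choose 2)" unfolding img by (simp add: card_image card_nsets)
  have "finite ?N" unfolding img using fin by simp
  have "?N \<inter> {{2, 7}, {2, 9}} = {}" by (auto simp: doubleton_eq_iff)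
  then have "card (nonedges k) = card ?N + card {{2, 7}, {2, 9 :: nat}}"
    unfolding nonedges_def by (intro card_Un_disjoint \<open>finite ?N\<close>) simp_all
  moreover have "card {{2, 7}, {2, 9 :: nat}} = 2" by (simp add: doubleton_eq_iff)
  ultimately show ?thesis using N by simp
qed

lemma real_choose_two: "real (m choose 2) = real m * (real m - 1) / 2"
  by (induction m) (simp_all add: numeral_2_eq_2 field_simps)

lemma real_choose_three: "real (m choose 3) = real m * (real m - 1) * (real m - 2) / 6"
proof (induction m)
  case (Suc m)
  have "Suc m choose 3 = (m choose 2) + (m choose 3)" by (simp add: numeral_3_eq_3 numeral_2_eq_2)
  then show ?case using Suc real_choose_two[of m] by (simp add: field_simps)
qed simp

lemma card_cone_triples:
  assumes "5 \<le> k" shows "real (card (cone_triples k)) = real k ^ 2 - 4"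
proof -
  let ?P = "nsets {1..2 * k} 2"
  have finP: "finite ?P" by (simp add: finite_imp_finite_nsets)
  have sub: "edges k \<union> nonedges k \<subseteq> ?P"
    using edges_subset[OF assms] nonedges_subset[OF assms] by blast
  have inj: "inj_on (insert (2 * k + 1)) (?P - (edges k \<union> nonedges k))"
  proof (rule inj_onI)
    fix p q assume "p \<in> ?P - (edges k \<union> nonedges k)" "q \<in> ?P - (edges k \<union> nonedges k)"
    then have "2 * k + 1 \<notin> p" "2 * k + 1 \<notin> q" by (auto simp: nsets_def)
    then show "insert (2 * k + 1) p = insert (2 * k + 1) q \<Longrightarrow> p = q" by (simp add: insert_ident)
  qed
  have finU: "finite (edges k \<union> nonedges k)" using finP sub finite_subset by blast
  then have "card (edges k \<union> nonedges k) = 2 * ((k choose 2) + 2)"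
    using edges_nonedges_disjoint[OF assms]
    by (simp add: card_Un_disjoint card_edges card_nonedges)
  moreover have "card (edges k \<union> nonedges k) \<le> card ?P" using finP sub by (rule card_mono)
  moreover have "card (cone_triples k) = card ?P - card (edges k \<union> nonedges k)"
    unfolding cone_triples_def card_image[OF inj] using finU sub by (rule card_Diff_subset)
  moreover have "card ?P = (2 * k choose 2)" by (simp add: card_nsets)
  ultimately have "real (card (cone_triples k)) = real (2 * k choose 2) - 2 * (real (k choose 2) + 2)"
    by simp
  then show ?thesis unfolding real_choose_two by (simp add: field_simps power2_eq_square)
qed

lemma card_odd_triples:
  "real (card (odd_triples k)) = real k * (real k - 1) * (real k - 2) / 6"
  unfolding odd_triples_def card_nsets card_odds real_choose_three ..

text \<open>
  Two even vertices form an edge, so an edge-free triple has at most one even vertex.  The only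
  further edges join 2 to 3 and to 5: with any other even vertex the two odd ones are arbitrary,
  with 2 they must avoid 3 and 5.
\<close>

lemma edge_free_triples_eq:
  fixes k :: nat
  defines "odds \<equiv> {i \<in> {1..2 * k + 1}. odd i}" and "evens \<equiv> {i \<in> {1..2 * k}. even i}"
  assumes k: "5 \<le> k"
  shows "{t \<in> nsets {1..2 * k + 1} 3. \<not> (\<exists>e\<in>edges k. e \<subseteq> t)} =
           nsets odds 3 \<union> (\<lambda>(i, p). insert i p) ` ((evens - {2}) \<times> nsets odds 2)
             \<union> insert 2 ` (nsets (odds - {3, 5}) 2)"
    (is "?free = ?A \<union> ?B \<union> ?C")
proof (rule subset_antisym; rule subsetI)
  fix t assume t: "t \<in> ?free"
  then have tV: "t \<subseteq> {1..2 * k + 1}" and fin: "finite t" and card: "card t = 3"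
    and free: "\<And>e. e \<in> edges k \<Longrightarrow> \<not> e \<subseteq> t"
    by (auto simp: nsets_def)
  show "t \<in> ?A \<union> ?B \<union> ?C"
  proof (cases "\<exists>i\<in>t. even i")
    case False
    then have "t \<in> ?A" using tV fin card by (auto simp: nsets_def odds_def)
    then show ?thesis by blast
  next
    case True
    have evensI: "j \<in> evens" if "j \<in> t" "even j" for j
    proof -
      have "1 \<le> j" "j \<le> 2 * k + 1" using tV that(1) by auto
      moreover have "j \<noteq> 2 * k + 1" using that(2) by auto
      ultimately show ?thesis using that(2) unfolding evens_def by simp
    qed
    from True obtain i where i: "i \<in> t" "even i" by blast
    then have i_range: "i \<in> evens" by (rule evensI)
    have "odd j" if j: "j \<in> t" "j \<noteq> i" for j
    proof
      assume "even j"
      with j(1) have "j \<in> evens" by (rule evensI)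
      then have "{i, j} \<in> edges k" using i_range j unfolding edges_def evens_def by simp
      then show False using free i j by blast
    qed
    then have "t - {i} \<subseteq> odds" using tV unfolding odds_def by auto
    moreover have "card (t - {i}) = 2" using card i fin by simp
    ultimately have p: "t - {i} \<in> nsets odds 2" using fin by (simp add: nsets_def)
    have t_eq: "insert i (t - {i}) = t" using i by blast
    show ?thesis
    proof (cases "i = 2")
      case True
      have "{2, 3} \<in> edges k" "{2, 5} \<in> edges k" unfolding edges_def by simp_all
      then have "\<not> {2, 3} \<subseteq> t" "\<not> {2, 5} \<subseteq> t" using free by blast+
      then have "3 \<notin> t" "5 \<notin> t" using True i by simp_all
      then have "t - {2} \<in> nsets (odds - {3, 5}) 2" using p True by (auto simp: nsets_def)
      then have "t \<in> ?C" using t_eq True by (metis imageI)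
      then show ?thesis by blast
    next
      case False
      then have "(i, t - {i}) \<in> (evens - {2}) \<times> nsets odds 2" using i_range p by simp
      then have "t \<in> ?B" by (rule rev_image_eqI) (simp add: insert_absorb i)
      then show ?thesis by blast
    qed
  qed
next
  fix t assume "t \<in> ?A \<union> ?B \<union> ?C"
  then consider "t \<in> nsets odds 3"
    | i p where "t = insert i p" "i \<in> evens" "i \<noteq> 2" "p \<in> nsets odds 2"
    | p where "t = insert 2 p" "p \<in> nsets (odds - {3, 5}) 2"
    by auto
  then show "t \<in> ?free"
  proof cases
    case 1
    have "\<not> e \<subseteq> t" if "e \<in> edges k" for e
      using even_in_edge_or_nonedge[of e k] that 1 by (auto simp: nsets_def odds_def)
    then show ?thesis using 1 by (auto simp: nsets_def odds_def)
  next
    case (2 i p)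
    have "i \<notin> p" using 2 by (auto simp: nsets_def odds_def evens_def)
    then have "t \<in> nsets {1..2 * k + 1} 3"
      using 2 by (auto simp: nsets_def odds_def evens_def)
    moreover have "\<not> e \<subseteq> t" if "e \<in> edges k" for e
    proof
      assume e: "e \<subseteq> t"
      have only: "j = i" if "j \<in> t" "even j" for j
        using that 2 by (auto simp: nsets_def odds_def)
      have "e \<in> nsets {i \<in> {1..2 * k}. even i} 2 \<or> 2 \<in> e" using that unfolding edges_def by auto
      then show False
      proof
        assume "e \<in> nsets {i \<in> {1..2 * k}. even i} 2"
        then obtain a b where "e = {a, b}" "a < b" "even a" "even b" by (elim ordered_pairE) simp
        then show False using only[of a] only[of b] e by simp
      next
        assume "2 \<in> e"
        then show False using only[of 2] e 2 by auto
      qed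
    qed
    ultimately show ?thesis by blast
  next
    case (3 p)
    have two: "2 \<notin> p" using 3 by (auto simp: nsets_def odds_def)
    then have "t \<in> nsets {1..2 * k + 1} 3"
      using 3 k by (auto simp: nsets_def odds_def)
    moreover have "\<not> e \<subseteq> t" if "e \<in> edges k" for e
    proof
      assume e: "e \<subseteq> t"
      have only: "j = 2" if "j \<in> t" "even j" for j
        using that 3 by (auto simp: nsets_def odds_def)
      have "3 \<notin> t" "5 \<notin> t" using 3 by (auto simp: nsets_def)
      then have "e \<in> nsets {i \<in> {1..2 * k}. even i} 2" using that e unfolding edges_def by auto
      then obtain a b where "e = {a, b}" "a < b" "even a" "even b" by (elim ordered_pairE) simp
      then show False using only[of a] only[of b] e by simp
    qed
    ultimately show ?thesis by blast
  qed
qed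

lemma card_edge_free_triples:
  assumes k: "5 \<le> k"
  shows "real (card {t \<in> nsets {1..2 * k + 1} 3. \<not> (\<exists>e\<in>edges k. e \<subseteq> t)}) =
           (4 * real k ^ 3 + 3 * real k ^ 2 - 13 * real k + 6) / 6"
proof -
  let ?odds = "{i \<in> {1..2 * k + 1}. odd i}" and ?evens = "{i \<in> {1..2 * k}. even i}"
  let ?A = "nsets ?odds 3"
  let ?D = "(?evens - {2}) \<times> nsets ?odds 2"
  let ?B = "(\<lambda>(i, p). insert i p) ` ?D"
  let ?C = "insert 2 ` nsets (?odds - {3, 5}) 2"
  have fin: "finite (nsets ?odds j)" "finite (nsets (?odds - {3, 5}) j)" for j
    by (intro finite_imp_finite_nsets, simp)+
  have finB: "finite ?B" using fin(1) by simp
  \<comment> \<open>The even members of a triple recover which of the three parts it belongs to.\<close>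
  have evenA: "{j \<in> t. even j} = {}" if "t \<in> ?A" for t using that by (auto simp: nsets_def)
  have evenB: "{j \<in> insert i p. even j} = {i}" "{j \<in> insert i p. odd j} = p"
    if "i \<in> ?evens" "p \<in> nsets ?odds 2" for i p
    using that by (auto simp: nsets_def)
  have evenC: "{j \<in> insert 2 p. even j} = {2}" "{j \<in> insert 2 p. odd j} = p"
    if "p \<in> nsets (?odds - {3, 5}) 2" for p
    using that by (auto simp: nsets_def)
  have AB: "?A \<inter> ?B = {}"
  proof -
    have "insert i p \<notin> ?A" if "i \<in> ?evens" "p \<in> nsets ?odds 2" for i p
      using evenA[of "insert i p"] evenB(1)[OF that] by (metis insert_not_empty)
    then show ?thesis by auto
  qed
  have ABC: "(?A \<union> ?B) \<inter> ?C = {}"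
  proof -
    have notA: "insert 2 q \<notin> ?A" if "q \<in> nsets (?odds - {3, 5}) 2" for q
      using evenA[of "insert 2 q"] evenC(1)[OF that] by (metis insert_not_empty)
    have notB: "insert 2 q \<notin> ?B" if q: "q \<in> nsets (?odds - {3, 5}) 2" for q
    proof
      assume "insert 2 q \<in> ?B"
      then obtain i p where ip: "i \<in> ?evens" "i \<noteq> 2" "p \<in> nsets ?odds 2" "insert 2 q = insert i p"
        by auto
      have "{i} = {2}" using evenB(1)[OF ip(1,3)] unfolding ip(4)[symmetric] evenC(1)[OF q] by simp
      then show False using ip(2) by simp
    qed
    show ?thesis
    proof (rule equals0I)
      fix t assume t: "t \<in> (?A \<union> ?B) \<inter> ?C"
      then obtain q where q: "t = insert 2 q" "q \<in> nsets (?odds - {3, 5}) 2"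
        by (elim IntE imageE)
      from t have "t \<in> ?A \<or> t \<in> ?B" by (simp only: Int_iff Un_iff)
      then show False unfolding q(1) using notA[OF q(2)] notB[OF q(2)] by satx
    qed
  qed
  have injB: "inj_on (\<lambda>(i, p). insert i p) ?D"
  proof (rule inj_onI)
    fix x y assume xy: "x \<in> ?D" "y \<in> ?D" "(\<lambda>(i, p). insert i p) x = (\<lambda>(i, p). insert i p) y"
    obtain i p where x: "x = (i, p)" "i \<in> ?evens" "p \<in> nsets ?odds 2" using xy(1) by auto
    obtain j q where y: "y = (j, q)" "j \<in> ?evens" "q \<in> nsets ?odds 2" using xy(2) by auto
    have eq: "insert i p = insert j q" using xy(3) x(1) y(1) by simp
    have "{i} = {j}" using evenB(1)[OF x(2,3)] unfolding eq evenB(1)[OF y(2,3)] by simp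
    moreover have "p = q" using evenB(2)[OF x(2,3)] unfolding eq evenB(2)[OF y(2,3)] by simp
    ultimately show "x = y" using x(1) y(1) by simp
  qed
  have B: "card ?B = (k - 1) * ((k + 1) choose 2)"
  proof -
    have "2 \<in> ?evens" using k by simp
    then have "card (?evens - {2}) = k - 1" by (simp only: card_Diff_singleton card_evens)
    then show ?thesis
      by (simp only: card_image[OF injB] card_cartesian_product card_nsets card_odds_Suc)
  qed
  have "inj_on (insert 2) (nsets (?odds - {3, 5}) 2)"
  proof (rule inj_onI)
    fix p q assume pq: "p \<in> nsets (?odds - {3, 5}) 2" "q \<in> nsets (?odds - {3, 5}) 2"
      "insert 2 p = insert 2 q"
    show "p = q" using evenC(2)[OF pq(1)] unfolding pq(3) evenC(2)[OF pq(2)] by simp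
  qed
  moreover have "card (?odds - {3, 5}) = k - 1"
  proof -
    have "{3, 5} \<subseteq> ?odds" using k by auto
    then have "card (?odds - {3, 5}) = card ?odds - card {3, 5 :: nat}"
      by (intro card_Diff_subset) simp_all
    then show ?thesis unfolding card_odds_Suc by simp
  qed
  ultimately have C: "card ?C = (k - 1 choose 2)" by (simp only: card_image card_nsets)
  have "card (?A \<union> ?B \<union> ?C) = card ?A + card ?B + card ?C"
    using fin finB by (simp only: card_Un_disjoint[OF _ _ ABC] card_Un_disjoint[OF _ _ AB]
        finite_UnI finite_imageI)
  then have "card {t \<in> nsets {1..2 * k + 1} 3. \<not> (\<exists>e\<in>edges k. e \<subseteq> t)} =
      ((k + 1) choose 3) + (k - 1) * ((k + 1) choose 2) + (k - 1 choose 2)"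
    unfolding edge_free_triples_eq[OF k] B C by (simp only: card_nsets card_odds_Suc)
  then show ?thesis
    using k by (simp add: real_choose_two real_choose_three of_nat_diff field_simps
        power2_eq_square power3_eq_cube)
qed

section \<open>Containment among pairs, triples and four-sets\<close>

lemma cone_triples_subset: "cone_triples k \<subseteq> nsets {1..2 * k + 1} 3"
proof
  fix t assume "t \<in> cone_triples k"
  then obtain p where p: "t = insert (2 * k + 1) p" "p \<in> nsets {1..2 * k} 2"
    unfolding cone_triples_def by blast
  have "2 * k + 1 \<notin> p" using p(2) by (auto simp: nsets_def)
  then show "t \<in> nsets {1..2 * k + 1} 3" using p by (auto simp: nsets_def)
qed

lemma odd_triples_subset: "odd_triples k \<subseteq> nsets {1..2 * k + 1} 3"
  unfolding odd_triples_def by (rule nsets_mono) auto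

text \<open>
  The pairs at the apex \<open>2k + 1\<close> of the cone are neither edges nor non-edges, so a cone triple can
  only contain such a pair by containing its base, which was chosen to avoid them.
\<close>

lemma cone_triple_free:
  assumes k: "5 \<le> k" and t: "t \<in> cone_triples k" and p: "p \<in> edges k \<union> nonedges k"
  shows "\<not> p \<subseteq> t"
proof
  assume sub: "p \<subseteq> t"
  obtain q where q: "t = insert (2 * k + 1) q" "q \<in> nsets {1..2 * k} 2" "q \<notin> edges k \<union> nonedges k"
    using t unfolding cone_triples_def by blast
  have pV: "p \<in> nsets {1..2 * k} 2" using p edges_subset[OF k] nonedges_subset[OF k] by blast
  then have "2 * k + 1 \<notin> p" by (auto simp: nsets_def)
  then have "p \<subseteq> q" using sub q(1) by blast
  then have "p = q" using pV q(2) by (intro card_subset_eq) (auto simp: nsets_def)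
  then show False using p q(3) by blast
qed

lemma odd_triple_free:
  assumes "t \<in> odd_triples k" "p \<in> edges k \<union> nonedges k"
  shows "\<not> p \<subseteq> t"
  using assms(1) even_in_edge_or_nonedge[OF assms(2)] by (auto simp: odd_triples_def nsets_def)

text \<open>
  Without two even vertices, at least three of the four are odd.  They form an odd triple if the
  apex is not among them; otherwise the apex and two of the others form a cone triple.
\<close>

lemma four_set_contains_generator:
  assumes F: "F \<in> nsets {1..2 * k + 1} 4"
  shows "\<exists>s\<in>edges k \<union> (cone_triples k \<union> odd_triples k). s \<subseteq> F"
proof -
  have FV: "F \<subseteq> {1..2 * k + 1}" and fin: "finite F" and card: "card F = 4"
    using F by (auto simp: nsets_def)
  let ?ev = "{i \<in> F. even i}" and ?od = "{i \<in> F. odd i}"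
  have split: "card ?ev + card ?od = 4"
  proof -
    have "?ev \<union> ?od = F" "?ev \<inter> ?od = {}" by auto
    then show ?thesis using card_Un_disjoint[of ?ev ?od] fin card by simp
  qed
  consider "2 \<le> card ?ev" | "3 \<le> card ?od" "2 * k + 1 \<notin> F" | "3 \<le> card ?od" "2 * k + 1 \<in> F"
    using split by linarith
  then show ?thesis
  proof cases
    case 1
    obtain p where p: "p \<subseteq> ?ev" "card p = 2" "finite p"
      by (rule obtain_subset_with_card_n[OF 1])
    have "i \<in> {1..2 * k}" if "i \<in> p" for i
    proof -
      have "i \<in> {1..2 * k + 1}" "even i" using that p(1) FV by auto
      moreover from this have "i \<noteq> 2 * k + 1" by auto
      ultimately show ?thesis by simp
    qed
    then have "p \<in> edges k" using p unfolding edges_def nsets_def by auto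
    then show ?thesis using p(1) by blast
  next
    case 2
    obtain t where t: "t \<subseteq> ?od" "card t = 3" "finite t"
      by (rule obtain_subset_with_card_n[OF 2(1)])
    have "i \<in> {1..2 * k}" if "i \<in> t" for i
    proof -
      have "i \<in> {1..2 * k + 1}" "i \<noteq> 2 * k + 1" using that t(1) FV 2(2) by auto
      then show ?thesis by simp
    qed
    then have "t \<in> odd_triples k" using t unfolding odd_triples_def nsets_def by auto
    then show ?thesis using t(1) by blast
  next
    case 3
    then have two: "2 \<le> card (?od - {2 * k + 1})" using fin by simp
    obtain p where p: "p \<subseteq> ?od - {2 * k + 1}" "card p = 2" "finite p"
      by (rule obtain_subset_with_card_n[OF two])
    have "i \<in> {1..2 * k}" if "i \<in> p" for i
    proof -
      have "i \<in> {1..2 * k + 1}" "i \<noteq> 2 * k + 1" using that p(1) FV by auto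
      then show ?thesis by simp
    qed
    then have "p \<in> nsets {1..2 * k} 2" using p by (auto simp: nsets_def)
    moreover have "p \<notin> edges k \<union> nonedges k" using even_in_edge_or_nonedge p(1) by blast
    ultimately have "insert (2 * k + 1) p \<in> cone_triples k" unfolding cone_triples_def by blast
    then show ?thesis using p(1) 3(2) by (intro bexI[of _ "insert (2 * k + 1) p"]) auto
  qed
qed

text \<open>
  A partner of \<open>i\<close> for the base of the cone triple is its predecessor if \<open>i\<close> is even, and another
  odd vertex if \<open>i\<close> is odd: neither choice gives an edge or a non-edge.
\<close>

lemma vertex_in_cone_triple:
  assumes k: "5 \<le> k" and i: "1 \<le> i" "i \<le> 2 * k"
  shows "\<exists>t\<in>cone_triples k. {i, 2 * k + 1} \<subseteq> t"
proof -
  obtain p where p: "i \<in> p" "p \<in> nsets {1..2 * k} 2" "p \<notin> edges k \<union> nonedges k"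
  proof (cases "even i")
    case True
    let ?p = "{i - 1, i}"
    have "odd (i - 1)" "i - 1 < i" "i - 1 + 1 = i" using True i by auto
    then have "?p \<notin> edges k" "?p \<notin> nonedges k"
      using edges_iff[of "i - 1" i k] nonedges_iff[of "i - 1" i k] by auto
    moreover have "1 \<le> i - 1" using True i(1) by (cases "i = 1") auto
    then have "?p \<in> nsets {1..2 * k} 2" using i by auto
    ultimately show ?thesis using that[of ?p] by blast
  next
    case False
    let ?j = "(if i = 1 then 3 else 1) :: nat"
    have "odd ?j" "?j \<noteq> i" "1 \<le> ?j" "?j \<le> 2 * k" using k by auto
    then have "{i, ?j} \<in> nsets {1..2 * k} 2" using i by simp
    moreover have "{i, ?j} \<notin> edges k \<union> nonedges k"
      using even_in_edge_or_nonedge[of "{i, ?j}" k] False by auto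
    ultimately show ?thesis using that[of "{i, ?j}"] by blast
  qed
  then have "insert (2 * k + 1) p \<in> cone_triples k" unfolding cone_triples_def by blast
  then show ?thesis using p(1) by blast
qed

text \<open>
  A pair containing the apex is covered by a cone triple through its other vertex, and a pair inside
  \<open>{1..2k}\<close> outside \<open>nonedges\<close> is an edge or the base of a cone triple.  The family \<open>C\<close> stands for
  any further triples; they cannot cover more as long as they contain no non-edge.
\<close>

lemma uncovered_pairs_eq_nonedges:
  assumes k: "5 \<le> k"
    and C: "C \<subseteq> nsets {1..2 * k + 1} 3" "\<forall>t\<in>C. \<forall>p\<in>nonedges k. \<not> p \<subseteq> t"
  shows "{p \<in> nsets {1..2 * k + 1} 2.
            \<not> (\<exists>s\<in>edges k \<union> (cone_triples k \<union> odd_triples k \<union> C). p \<subseteq> s)} = nonedges k"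
    (is "?L = _")
proof (rule subset_antisym; rule subsetI)
  fix p assume p: "p \<in> ?L"
  then have pV: "p \<in> nsets {1..2 * k + 1} 2" by blast
  then obtain i j where ij: "p = {i, j}" "i < j" "1 \<le> i" "j \<le> 2 * k + 1"
    by (elim ordered_pairE) auto
  have "j \<noteq> 2 * k + 1"
  proof
    assume "j = 2 * k + 1"
    then show False using vertex_in_cone_triple[OF k, of i] ij p by auto
  qed
  then have "p \<in> nsets {1..2 * k} 2" using ij by simp
  then show "p \<in> nonedges k"
    using p unfolding cone_triples_def by blast
next
  fix p assume p: "p \<in> nonedges k"
  have pV: "p \<in> nsets {1..2 * k} 2" using p nonedges_subset[OF k] by blast
  then have "p \<in> nsets {1..2 * k + 1} 2" by (auto simp: nsets_def)
  moreover have "\<not> p \<subseteq> s"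
    if s: "s \<in> edges k \<union> (cone_triples k \<union> odd_triples k \<union> C)" for s
  proof
    assume sub: "p \<subseteq> s"
    consider "s \<in> edges k" | "s \<in> cone_triples k" | "s \<in> odd_triples k" | "s \<in> C"
      using s by blast
    then show False
    proof cases
      case 1
      then have "s \<in> nsets {1..2 * k} 2" using edges_subset[OF k] by blast
      then have "p = s" using sub pV by (intro card_subset_eq) (auto simp: nsets_def)
      then show False using 1 p edges_nonedges_disjoint[OF k] by blast
    qed (use p sub C cone_triple_free[OF k] odd_triple_free in blast)+
  qed
  ultimately show "p \<in> ?L" by blast
qed

section \<open>The monomials of the family\<close>

lemma var_mult_var:
  assumes "i \<noteq> j"
  shows "(var i * var j :: 'a::field polynomial) = sqfree_monomial {i, j}"
  using assms by (simp add: sqfree_monomial_def)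

lemma var_mult_var_mult_var:
  assumes "i \<noteq> j" "i \<noteq> l" "j \<noteq> l"
  shows "(var i * var j * var l :: 'a::field polynomial) = sqfree_monomial {i, j, l}"
  using assms by (simp add: sqfree_monomial_def mult.assoc)

lemma sqfree_monomial_mem_image_iff:
  assumes "finite p" "\<forall>q\<in>X. finite q"
  shows "(sqfree_monomial p :: 'a::field polynomial) \<in> sqfree_monomial ` X \<longleftrightarrow> p \<in> X"
proof
  assume "(sqfree_monomial p :: 'a polynomial) \<in> sqfree_monomial ` X"
  then obtain q where q: "q \<in> X" "(sqfree_monomial p :: 'a polynomial) = sqfree_monomial q" by auto
  then have "p = q" using assms by (intro sqfree_monomial_inj[where ?'a='a]) auto
  then show "p \<in> X" using q(1) by simp
qed simp

lemma edge_monomials: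
  "{var (2 * i) * var (2 * j) | i j. 1 \<le> i \<and> i < j \<and> j \<le> k} \<union> {var 3 * var 2, var 5 * var 2} =
     (sqfree_monomial ` edges k :: 'a::field polynomial set)"
proof -
  have evens: "nsets {i \<in> {1..2 * k}. even i} 2 = {{2 * i, 2 * j} | i j. 1 \<le> i \<and> i < j \<and> j \<le> k}"
    (is "?L = ?R")
  proof (rule subset_antisym; rule subsetI)
    fix p assume "p \<in> ?L"
    then obtain a b where ab: "p = {a, b}" "a < b" "even a" "even b" "1 \<le> a" "b \<le> 2 * k"
      by (elim ordered_pairE) simp
    then obtain i j where "a = 2 * i" "b = 2 * j" by (auto elim!: evenE)
    with ab have "p = {2 * i, 2 * j} \<and> 1 \<le> i \<and> i < j \<and> j \<le> k" by auto
    then show "p \<in> ?R" by blast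
  next
    fix p assume "p \<in> ?R"
    then obtain i j where "p = {2 * i, 2 * j}" "1 \<le> i" "i < j" "j \<le> k" by blast
    then show "p \<in> ?L" by simp
  qed
  have "{var (2 * i) * var (2 * j) | i j. 1 \<le> i \<and> i < j \<and> j \<le> k} =
          (sqfree_monomial ` ?R :: 'a polynomial set)" (is "?V = _")
  proof (rule subset_antisym; rule subsetI)
    fix x assume "x \<in> ?V"
    then obtain i j where ij: "x = var (2 * i) * var (2 * j)" "1 \<le> i" "i < j" "j \<le> k" by blast
    then have "x = sqfree_monomial {2 * i, 2 * j}" by (simp add: var_mult_var)
    moreover have "{2 * i, 2 * j} \<in> ?R" using ij by blast
    ultimately show "x \<in> sqfree_monomial ` ?R" by (rule image_eqI)
  next
    fix x :: "'a polynomial" assume "x \<in> sqfree_monomial ` ?R"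
    then obtain i j where ij: "x = sqfree_monomial {2 * i, 2 * j}" "1 \<le> i" "i < j" "j \<le> k"
      by blast
    then have "x = var (2 * i) * var (2 * j)" by (simp add: var_mult_var)
    then show "x \<in> ?V" using ij by blast
  qed
  moreover have "{var 3 * var 2, var 5 * var 2} =
      (sqfree_monomial ` {{2, 3}, {2, 5}} :: 'a polynomial set)"
    by (simp add: var_mult_var insert_commute)
  ultimately show ?thesis unfolding edges_def evens image_Un by (simp only:)
qed

lemma nonedge_monomials:
  "{var i * var j | i j. 1 \<le> i \<and> i \<le> 2 * k + 1 \<and> 1 \<le> j \<and> j \<le> 2 * k + 1 \<and> odd i \<and> even j \<and> i + 1 < j}
     \<union> {var 2 * var 7, var 2 * var 9} = (sqfree_monomial ` nonedges k :: 'a::field polynomial set)"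
proof -
  let ?N = "{{i, j} | i j. odd i \<and> even j \<and> i + 1 < j \<and> j \<le> 2 * k}"
  have "{var i * var j | i j. 1 \<le> i \<and> i \<le> 2 * k + 1 \<and> 1 \<le> j \<and> j \<le> 2 * k + 1
            \<and> odd i \<and> even j \<and> i + 1 < j} = (sqfree_monomial ` ?N :: 'a polynomial set)" (is "?V = _")
  proof (rule subset_antisym; rule subsetI)
    fix x assume "x \<in> ?V"
    then obtain i j where ij: "x = var i * var j" "odd i" "even j" "i + 1 < j" "j \<le> 2 * k + 1" by blast
    then have "x = sqfree_monomial {i, j}" by (simp add: var_mult_var)
    moreover have "j \<noteq> 2 * k + 1" using ij(3) by auto
    then have "{i, j} \<in> ?N" using ij by fastforce
    ultimately show "x \<in> sqfree_monomial ` ?N" by (rule image_eqI)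
  next
    fix x :: "'a polynomial" assume "x \<in> sqfree_monomial ` ?N"
    then obtain i j where ij: "x = sqfree_monomial {i, j}" "odd i" "even j" "i + 1 < j" "j \<le> 2 * k"
      by blast
    then have "x = var i * var j" by (simp add: var_mult_var)
    moreover have "1 \<le> i" "i \<le> 2 * k + 1" "1 \<le> j" "j \<le> 2 * k + 1" using ij by (auto elim: oddE)
    ultimately show "x \<in> ?V" using ij by blast
  qed
  moreover have "{var 2 * var 7, var 2 * var 9} =
      (sqfree_monomial ` {{2, 7}, {2, 9}} :: 'a polynomial set)"
    by (simp add: var_mult_var)
  ultimately show ?thesis unfolding nonedges_def image_Un by (simp only:)
qed

lemma cone_triple_monomials:
  assumes k: "5 \<le> k"
  shows "{var i * var j * var (2 * k + 1) | i j. 1 \<le> i \<and> i < j \<and> j \<le> 2 * k \<and>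
            (var i * var j :: 'a::field polynomial) \<notin> sqfree_monomial ` edges k \<union> sqfree_monomial ` nonedges k} =
         (sqfree_monomial ` cone_triples k :: 'a::field polynomial set)" (is "?V = _")
proof -
  have fin: "\<forall>p\<in>edges k \<union> nonedges k. finite p"
    using edges_subset[OF k] nonedges_subset[OF k] by (auto simp: nsets_def)
  have base: "(var i * var j :: 'a polynomial) \<notin> sqfree_monomial ` edges k \<union> sqfree_monomial ` nonedges k
      \<longleftrightarrow> {i, j} \<notin> edges k \<union> nonedges k" if "i < j" for i j
    using sqfree_monomial_mem_image_iff[OF _ fin, of "{i, j}", where ?'a='a] that
    by (simp add: var_mult_var image_Un)
  have triple: "(var i * var j * var (2 * k + 1) :: 'a polynomial) =
      sqfree_monomial (insert (2 * k + 1) {i, j})" if "i < j" "j \<le> 2 * k" for i j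
  proof -
    have "insert (2 * k + 1) {i, j} = {i, j, 2 * k + 1}" by blast
    then show ?thesis using that by (simp only: var_mult_var_mult_var)
  qed
  show ?thesis
  proof (rule subset_antisym; rule subsetI)
    fix x assume "x \<in> ?V"
    then obtain i j where ij: "x = var i * var j * var (2 * k + 1)" "1 \<le> i" "i < j" "j \<le> 2 * k"
      "var i * var j \<notin> (sqfree_monomial ` edges k \<union> sqfree_monomial ` nonedges k :: 'a polynomial set)"
      by blast
    then have "{i, j} \<in> nsets {1..2 * k} 2" "{i, j} \<notin> edges k \<union> nonedges k"
      using base[OF ij(3)] by auto
    then have "insert (2 * k + 1) {i, j} \<in> cone_triples k" unfolding cone_triples_def by blast
    then show "x \<in> sqfree_monomial ` cone_triples k"
      using ij(1) triple[OF ij(3,4)] by (intro image_eqI) simp_all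
  next
    fix x :: "'a polynomial" assume "x \<in> sqfree_monomial ` cone_triples k"
    then obtain p where p: "x = sqfree_monomial (insert (2 * k + 1) p)" "p \<in> nsets {1..2 * k} 2"
      "p \<notin> edges k \<union> nonedges k"
      unfolding cone_triples_def by blast
    from p(2) obtain i j where ij: "p = {i, j}" "i < j" "i \<in> {1..2 * k}" "j \<in> {1..2 * k}"
      by (elim ordered_pairE)
    have "x = var i * var j * var (2 * k + 1)" using p(1) ij triple[of i j] by simp
    moreover have "var i * var j \<notin>
        (sqfree_monomial ` edges k \<union> sqfree_monomial ` nonedges k :: 'a polynomial set)"
      using base[OF ij(2)] p(3) ij(1) by blast
    ultimately show "x \<in> ?V" using ij by fastforce
  qed
qed

lemma odd_triple_monomials:
  "{var i * var j * var l | i j l. 1 \<le> i \<and> i < j \<and> j < l \<and> l \<le> 2 * k \<and> odd i \<and> odd j \<and> odd l} =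
     (sqfree_monomial ` odd_triples k :: 'a::field polynomial set)" (is "?V = _")
proof (rule subset_antisym; rule subsetI)
  fix x assume "x \<in> ?V"
  then obtain i j l where x: "x = var i * var j * var l" and
    ijl: "1 \<le> i" "i < j" "j < l" "l \<le> 2 * k" "odd i" "odd j" "odd l" by blast
  have "x = sqfree_monomial {i, j, l}" using x ijl by (simp add: var_mult_var_mult_var)
  moreover have "{i, j, l} \<in> odd_triples k"
    unfolding odd_triples_def using ijl by (auto simp: nsets_def)
  ultimately show "x \<in> sqfree_monomial ` odd_triples k" by (rule image_eqI)
next
  fix x :: "'a polynomial" assume "x \<in> sqfree_monomial ` odd_triples k"
  then obtain t where t: "x = sqfree_monomial t" "t \<in> odd_triples k" by blast
  from t(2) obtain i j l where ijl: "t = {i, j, l}" "i < j" "j < l"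
    "i \<in> {1..2 * k}" "l \<in> {1..2 * k}" "odd i" "odd j" "odd l"
    unfolding odd_triples_def ordered_nsets_3_eq by auto
  have "x = var i * var j * var l" using t(1) ijl by (simp add: var_mult_var_mult_var)
  then show "x \<in> ?V" using ijl by auto
qed

theorem theorem4p5:
  fixes n k :: nat
    and G1 NF G2 G3 G4 I :: "'a::field polynomial set"
  assumes n_def: "n = 2 * k + 1"
    and k_ge: "k \<ge> 15"
    and k_mod: "k mod 4 = 1 \<or> k mod 4 = 2"
    and G1_def: "G1 = {var (2 * i) * var (2 * j) | i j. 1 \<le> i \<and> i < j \<and> j \<le> k}
                      \<union> {var 3 * var 2, var 5 * var 2}"
    and NF_def: "NF = {var i * var j | i j.
                         1 \<le> i \<and> i \<le> n \<and> 1 \<le> j \<and> j \<le> n \<and> odd i \<and> even j \<and> i + 1 < j}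
                      \<union> {var 2 * var 7, var 2 * var 9}"
    and G2_def: "G2 = {var i * var j * var (2 * k + 1) | i j.
                         1 \<le> i \<and> i < j \<and> j \<le> 2 * k \<and> var i * var j \<notin> G1 \<union> NF}"
    and G3_def: "G3 = {var i * var j * var l | i j l.
                         1 \<le> i \<and> i < j \<and> j < l \<and> l \<le> 2 * k \<and> odd i \<and> odd j \<and> odd l}"
    and G4_sub: "G4 \<subseteq> {sqfree_monomial F | F. F \<subseteq> {1..n} \<and> card F = 3}"
    and G4_card: "real (card G4) =
                    1 / 2 * ((4 * real k ^ 3 + 3 * real k ^ 2 - 13 * real k + 6) / 6)
                    - (real k * (real k - 1) * (real k - 2) + 6 * real k ^ 2 - 24) / 6"
    and G4_new: "\<forall>g\<in>G4. g \<notin> G2 \<union> G3"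
    and G4_div: "\<forall>g\<in>G4. \<forall>d\<in>G1 \<union> NF. \<not> d dvd g"
    and I_def: "I = Idl\<^bsub>poly_ring n\<^esub> (G1 \<union> G2 \<union> G3 \<union> G4)"
  shows "f_ideal n I"
proof -
  have k: "5 \<le> k" using k_ge by simp
  have G1: "G1 = sqfree_monomial ` edges k" unfolding G1_def by (rule edge_monomials)
  have NF: "NF = sqfree_monomial ` nonedges k"
    unfolding NF_def n_def by (rule nonedge_monomials)
  have G2: "G2 = sqfree_monomial ` cone_triples k"
    unfolding G2_def G1 NF by (rule cone_triple_monomials[OF k])
  have G3: "G3 = sqfree_monomial ` odd_triples k" unfolding G3_def by (rule odd_triple_monomials)
  define C where "C = {F \<in> nsets {1..n} 3. (sqfree_monomial F :: 'a polynomial) \<in> G4}"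
  have C_sub: "C \<subseteq> nsets {1..n} 3" unfolding C_def by blast
  have G4: "G4 = sqfree_monomial ` C"
  proof (rule subset_antisym; rule subsetI)
    fix x assume x: "x \<in> G4"
    then obtain F where F: "x = sqfree_monomial F" "F \<subseteq> {1..n}" "card F = 3" using G4_sub by blast
    then have "F \<in> C" unfolding C_def nsets_1_to_eq using x by simp
    then show "x \<in> sqfree_monomial ` C" using F(1) by blast
  next
    fix x :: "'a polynomial" assume "x \<in> sqfree_monomial ` C"
    then show "x \<in> G4" unfolding C_def by auto
  qed
  have finC: "finite F" if "F \<in> C" for F using that C_sub by (auto simp: nsets_def)
  have "inj_on (sqfree_monomial :: _ \<Rightarrow> 'a polynomial) C"
    using sqfree_monomial_inj[OF finC finC, where ?'a='a] by (simp add: inj_on_def)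
  then have card_C: "card G4 = card C" unfolding G4 by (rule card_image)
  \<comment> \<open>Divisibility between squarefree monomials is inclusion of their supports.\<close>
  have C_free: "\<not> p \<subseteq> t" if t: "t \<in> C" and p: "p \<in> edges k \<union> nonedges k" for t p
  proof
    assume sub: "p \<subseteq> t"
    then have "(sqfree_monomial p :: 'a polynomial) dvd sqfree_monomial t"
      by (simp only: sqfree_monomial_dvd_iff[OF finite_subset[OF sub finC[OF t]] finC[OF t]])
    moreover have "sqfree_monomial p \<in> G1 \<union> NF" using p unfolding G1 NF by blast
    moreover have "sqfree_monomial t \<in> G4" using t unfolding G4 by blast
    ultimately show False using G4_div by blast
  qed
  have C_new: "C \<inter> (cone_triples k \<union> odd_triples k) = {}"
    using G4_new unfolding G2 G3 G4 by blast

  let ?T = "cone_triples k \<union> odd_triples k \<union> C"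
  have T_sub: "?T \<subseteq> nsets {1..n} 3"
    using cone_triples_subset odd_triples_subset C_sub unfolding n_def by blast
  have fin3: "finite (nsets {1..n} 3)" by (simp add: finite_imp_finite_nsets)
  have fins: "finite (cone_triples k)" "finite (odd_triples k)" "finite C"
    using T_sub finite_subset[OF _ fin3] by simp_all
  have "2 * k + 1 \<in> t" if "t \<in> cone_triples k" for t
    using that unfolding cone_triples_def by blast
  moreover have "2 * k + 1 \<notin> t" if "t \<in> odd_triples k" for t
    using that unfolding odd_triples_def nsets_def by auto
  ultimately have "cone_triples k \<inter> odd_triples k = {}" by blast
  then have "card ?T = card (cone_triples k) + card (odd_triples k) + card C"
    using C_new fins by (simp add: card_Un_disjoint Int_commute)
  \<comment> \<open>The prescribed size of \<open>G4\<close> is half the number of edge-free triples minus the sizes of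
    \<open>G2\<close> and \<open>G3\<close>.\<close>
  then have "real (2 * card ?T) =
      real (card {t \<in> nsets {1..n} 3. \<not> (\<exists>e\<in>edges k. e \<subseteq> t)})"
    unfolding n_def card_edge_free_triples[OF k]
    using G4_card card_cone_triples[OF k] card_odd_triples[of k] unfolding card_C
    by (simp add: field_simps)
  then have triples: "card {t \<in> nsets {1..n} 3. \<not> (\<exists>e\<in>edges k. e \<subseteq> t)} = 2 * card ?T"
    by (simp only: of_nat_eq_iff)
  have "f_ideal n (Idl\<^bsub>poly_ring n\<^esub> (sqfree_monomial ` (edges k \<union> ?T) :: 'a polynomial set))"
  proof (rule f_ideal_of_pairs_and_triples)
    show "edges k \<subseteq> nsets {1..n} 2"
      using edges_subset[OF k] nsets_mono[of "{1..2 * k}" "{1..n}" 2] unfolding n_def by auto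
    show "?T \<subseteq> nsets {1..n} 3" by (rule T_sub)
    show "?T \<noteq> {}" using vertex_in_cone_triple[OF k, of 1] k by auto
    show "\<not> e \<subseteq> t" if "e \<in> edges k" "t \<in> ?T" for e t
      using that cone_triple_free[OF k] odd_triple_free C_free by blast
    show "\<exists>s\<in>edges k \<union> ?T. s \<subseteq> F" if "F \<in> nsets {1..n} 4" for F
      using four_set_contains_generator[of F k] that unfolding n_def by blast
    show "\<exists>s\<in>edges k \<union> ?T. v \<in> s" if "v \<in> {1..n}" for v
    proof (cases "v \<le> 2 * k")
      case True
      then show ?thesis using vertex_in_cone_triple[OF k, of v] that by auto
    next
      case False
      then have "v = 2 * k + 1" using that n_def by auto
      then show ?thesis using vertex_in_cone_triple[OF k, of 1] k by auto
    qed
    show "card {p \<in> nsets {1..n} 2. \<not> (\<exists>s\<in>edges k \<union> ?T. p \<subseteq> s)} = card (edges k)"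
    proof -
      have "{p \<in> nsets {1..n} 2. \<not> (\<exists>s\<in>edges k \<union> ?T. p \<subseteq> s)} = nonedges k"
        unfolding n_def
        by (rule uncovered_pairs_eq_nonedges[OF k]) (use C_sub C_free in \<open>auto simp: n_def\<close>)
      then show ?thesis by (simp only: card_edges card_nonedges)
    qed
    show "card {t \<in> nsets {1..n} 3. \<not> (\<exists>e\<in>edges k. e \<subseteq> t)} = 2 * card ?T" by (rule triples)
  qed
  then show ?thesis
    unfolding I_def G1 G2 G3 G4 by (simp only: image_Un Un_assoc)
qed

end
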